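(* Let $f=\widehat f_{|M}$ be the restriction to $M$ of a centered, unit variance Gaussian process $\widehat f$ on $\widehat M$, where $M$ is a piecewise $C^2$ $k$-dimensional submanifold of $\widehat M$. Suppose that the map $\Psi:x\mapsto \widehat f(x)$ is a $C^2$ embedding of $\widehat M$ into the Hilbert space $H_f$. Then, for all $x\in\partial M_k$, $$\sigma_c^2(f,x)=\cot^2\big(\theta_c(x)\big),$$ where $\sigma_c^2(f,x)=\sup_{y\in M\setminus\{x\}}\mathrm{Var}(f^x(y))$ and $\theta_c(x)=\theta_c(f(x))$ is the local critical radius of $\Psi(M)$ at $f(x)$ (all defined in the context).
   Context: **Parameter space.** $\widehat M$ is a $C^3$ manifold of dimension $q$, and $M\subset\widehat M$ is a compact embedded piecewise $C^2$ submanifold of dimension $k$: $M=\bigcup_{i=0}^k\partial M_i$ with $\partial M_i$ an $i$-dimensional $C^2$ manifold without boundary, and $\partial M_k=M^\circ$. For $x\in M$ the support cone $\mathcal S_xM\subset T_x\widehat M$ is the set of velocities $\dot c(0)$ of $C^1$ curves $c:(-\delta,\delta)\to\widehat M$ with $c(0)=x$ and $c(t)\in M$ for $t\in[0,\delta)$. For $x\in\partial M_i$, $T_x\partial M_i$ is the largest linear subspace contained in $\mathcal S_xM$; each $\mathcal S_xM$ is a convex cone; and for every $x\in M$ there is a diffeomorphism $\varphi_x:U_x\to\varphi_x(U_x)\subset T_x\widehat M$ of a neighbourhood $U_x$ of $x$ in $\widehat M$ whose inverse, restricted to $\mathcal S_xM$, maps any sufficiently small neighbourhood of the origin to a neighbourhood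 of $x$ in $M$. **The process $f^x$.** $\widehat M$ carries the Riemannian metric $\widehat g_x(X_x,Y_x)=\mathrm{Cov}(X_x\widehat f,Y_x\widehat f)$. The normal cone is $N_xM=\{X_x\in T_x\widehat M:\widehat g_x(X_x,Y_x)\le0\ \forall Y_x\in\mathcal S_xM\}$ with orthogonal projection $P_{N_xM}:T_x\widehat M\to N_xM$. Let $\rho(x,y)=\mathrm{Cor}(\widehat f(x),\widehat f(y))$, $F(x,y)=\sum_{j=1}^q\mathrm{Cov}(\widehat f(y),X_j\widehat f(x))X_{j,x}$ for an orthonormal basis $(X_{j,x})$ of $T_x\widehat M$, and $\widehat F^x(y)=F(x,y)-\rho(x,y)F(x,x)$ for $\rho(x,y)\neq 1$. For $x,y\in M$, $\rho(x,y)\neq1$, $$f^x(y)=\frac{f(y)-\rho(x,y)f(x)-\widehat g(\widehat F^x(y)-P_{N_xM}\widehat F^x(y),\nabla\widehat f(x))}{1-\rho(x,y)}.$$ **Critical radius.** $H_f\subset L^2(\Omega,\mathcal F,\mathrm P)$ is the closed linear span of the variables of the process (isometric to its reproducing kernel Hilbert space), with $\langle f(x),f(y)\rangle_{H_f}=\rho(x,y)$; $S(H_f)$ is its unit sphere with geodesic distance $d(a,b)=\cos^{-1}\langle a,b\rangle_{H_f}$, and $\Psi(M)\subset S(H_f)$. For $x\in\partial M_k$, $T_{f(x)}\Psi(M)$ is spanned by $\{X_xf: X_x\in T_x\partial M_k\}$; $N_{f(x)}\Psi(M)$ is its orthogonal complement in $T_{f(x)}S(H_f)$, and $S(N_{f(x)}\Psi(M))$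 is the set of unit vectors in it. For $v\in S(N_{f(x)}\Psi(M))$ let $c_{f(x),v}(t)=\cos t\cdot f(x)+\sin t\cdot v$, $0\le t<\pi$. The local critical radius $\theta(f(x),v)$ in the direction $v$ is the largest $t$ (supremum) such that the points of $c_{f(x),v}$ up to $t$ have $f(x)$ as their unique closest point in $\Psi(M)$. The local critical radius at $f(x)$ is $\theta_c(f(x))=\inf_{v\in S(N_{f(x)}\Psi(M))}\theta(f(x),v)$. *)

theory Defs
  imports "HOL-Probability.Probability"
begin

section \<open>Manifolds\<close>

text \<open>Meaningful for open \<open>S\<close> in a finite-dimensional space, where it is the usual class \<open>C\<^sup>n\<close>.\<close>

primrec Ck_on :: "nat \<Rightarrow> ('a::real_normed_vector \<Rightarrow> 'b::real_normed_vector) \<Rightarrow> 'a set \<Rightarrow> bool" where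
  "Ck_on 0 f S \<longleftrightarrow> continuous_on S f"
| "Ck_on (Suc n) f S \<longleftrightarrow> (\<forall>x\<in>S. f differentiable (at x)) \<and>
     (\<forall>v. Ck_on n (\<lambda>x. frechet_derivative f (at x) v) S)"

text \<open>A manifold is a Hausdorff, second countable type \<open>'m\<close> with an atlas of charts, which are
  pairs of a domain and a coordinate map into the model space \<open>'e\<close>; the dimension is \<open>DIM('e)\<close>.\<close>

type_synonym ('m, 'e) chart = "'m set \<times> ('m \<Rightarrow> 'e)"

definition chart_inv :: "('m, 'e) chart \<Rightarrow> 'e \<Rightarrow> 'm" where
  "chart_inv c = inv_into (fst c) (snd c)"

definition is_chart :: "('m::topological_space, 'e::euclidean_space) chart \<Rightarrow> bool" where
  "is_chart c \<longleftrightarrow> open (fst c) \<and> open (snd c ` fst c) \<and>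
     homeomorphism (fst c) (snd c ` fst c) (snd c) (chart_inv c)"

definition Ck_compatible ::
    "nat \<Rightarrow> ('m, 'e::euclidean_space) chart \<Rightarrow> ('m, 'e) chart \<Rightarrow> bool" where
  "Ck_compatible n c d \<longleftrightarrow>
     Ck_on n (snd d \<circ> chart_inv c) (snd c ` (fst c \<inter> fst d)) \<and>
     Ck_on n (snd c \<circ> chart_inv d) (snd d ` (fst c \<inter> fst d))"

definition Ck_atlas ::
    "nat \<Rightarrow> ('m::topological_space, 'e::euclidean_space) chart set \<Rightarrow> bool" where
  "Ck_atlas n A \<longleftrightarrow> (\<forall>c\<in>A. is_chart c) \<and> (\<forall>c\<in>A. \<forall>d\<in>A. Ck_compatible n c d) \<and>
     (\<Union>c\<in>A. fst c) = UNIV"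

text \<open>A \<open>C\<^sup>n\<close> diffeomorphism from the open set \<open>U\<close> onto an open subset of the model space.\<close>

definition Ck_diffeo ::
    "('m::topological_space, 'e::euclidean_space) chart set \<Rightarrow> nat \<Rightarrow> 'm set \<Rightarrow> ('m \<Rightarrow> 'e) \<Rightarrow> bool" where
  "Ck_diffeo A n U \<phi> \<longleftrightarrow> is_chart (U, \<phi>) \<and> (\<forall>c\<in>A. Ck_compatible n c (U, \<phi>))"

text \<open>A chart \<open>chart_at A x\<close> around each point is selected once and for all, and the tangent space
  at \<open>x\<close> is identified with \<open>'e\<close> through it: a tangent vector at \<open>x\<close> is given by its components
  in \<open>chart_at A x\<close>.\<close>

definition chart_at :: "('m, 'e) chart set \<Rightarrow> 'm \<Rightarrow> ('m, 'e) chart" where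
  "chart_at A x = (SOME c. c \<in> A \<and> x \<in> fst c)"

definition C1_curve ::
    "('m::topological_space, 'e::euclidean_space) chart set \<Rightarrow> real \<Rightarrow> (real \<Rightarrow> 'm) \<Rightarrow> bool" where
  "C1_curve A \<delta> c \<longleftrightarrow> continuous_on {-\<delta><..<\<delta>} c \<and>
     (\<forall>d\<in>A. Ck_on 1 (snd d \<circ> c) ({-\<delta><..<\<delta>} \<inter> c -` fst d))"

definition velocity :: "('m, 'e::euclidean_space) chart set \<Rightarrow> (real \<Rightarrow> 'm) \<Rightarrow> 'e" where
  "velocity A c = vector_derivative (snd (chart_at A (c 0)) \<circ> c) (at 0)"

section \<open>Piecewise \<open>C\<^sup>2\<close> submanifolds\<close>

definition C2_submanifold ::
    "('m::topological_space, 'e::euclidean_space) chart set \<Rightarrow> nat \<Rightarrow> 'm set \<Rightarrow> bool" where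
  "C2_submanifold A i N \<longleftrightarrow>
     (\<forall>x\<in>N. \<exists>U \<phi> L. x \<in> U \<and> Ck_diffeo A 2 U \<phi> \<and> subspace L \<and> dim L = i \<and>
        \<phi> ` (U \<inter> N) = \<phi> ` U \<inter> L)"

definition tangent_of ::
    "('m::topological_space, 'e::euclidean_space) chart set \<Rightarrow> 'm set \<Rightarrow> 'm \<Rightarrow> 'e set" where
  "tangent_of A N x =
     {velocity A c | c. \<exists>\<delta>>0. C1_curve A \<delta> c \<and> c 0 = x \<and> (\<forall>t\<in>{-\<delta><..<\<delta>}. c t \<in> N)}"

definition support_cone ::
    "('m::topological_space, 'e::euclidean_space) chart set \<Rightarrow> 'm set \<Rightarrow> 'm \<Rightarrow> 'e set" where
  "support_cone A M x =
     {velocity A c | c. \<exists>\<delta>>0. C1_curve A \<delta> c \<and> c 0 = x \<and> (\<forall>t\<in>{0..<\<delta>}. c t \<in> M)}"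

definition manifold_interior ::
    "('m::topological_space, 'e::euclidean_space) chart set \<Rightarrow> nat \<Rightarrow> 'm set \<Rightarrow> 'm set" where
  "manifold_interior A k M = {x\<in>M. \<exists>U. open U \<and> x \<in> U \<and> C2_submanifold A k (M \<inter> U)}"

definition largest_subspace_of :: "'e::real_vector set \<Rightarrow> 'e set \<Rightarrow> bool" where
  "largest_subspace_of S T \<longleftrightarrow>
     subspace T \<and> T \<subseteq> S \<and> (\<forall>L. subspace L \<and> L \<subseteq> S \<longrightarrow> L \<subseteq> T)"

text \<open>Near \<open>x\<close>, \<open>M\<close> is diffeomorphic to its support cone: the inverse of \<open>\<phi>\<close> takes every small
  neighbourhood \<open>V \<inter> support_cone A M x\<close> of the origin in the cone to a neighbourhood of \<open>x\<close>
  in \<open>M\<close>.\<close>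

definition locally_support_cone ::
    "('m::topological_space, 'e::euclidean_space) chart set \<Rightarrow> 'm set \<Rightarrow> 'm \<Rightarrow> bool" where
  "locally_support_cone A M x \<longleftrightarrow>
     (\<exists>U \<phi> W. x \<in> U \<and> Ck_diffeo A 1 U \<phi> \<and> open W \<and> 0 \<in> W \<and> W \<subseteq> \<phi> ` U \<and>
        (\<forall>V. open V \<and> 0 \<in> V \<and> V \<subseteq> W \<longrightarrow>
           inv_into U \<phi> ` (V \<inter> support_cone A M x) \<subseteq> M \<and>
           (\<exists>G. open G \<and> x \<in> G \<and> G \<inter> M \<subseteq> inv_into U \<phi> ` (V \<inter> support_cone A M x))))"

text \<open>\<open>bM i\<close> is the \<open>i\<close>-dimensional stratum.\<close>

definition piecewise_C2_submanifold ::
    "('m::topological_space, 'e::euclidean_space) chart set \<Rightarrow> nat \<Rightarrow> (nat \<Rightarrow> 'm set) \<Rightarrow> 'm set \<Rightarrow> bool" where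
  "piecewise_C2_submanifold A k bM M \<longleftrightarrow>
     M = (\<Union>i\<le>k. bM i) \<and>
     (\<forall>i\<le>k. C2_submanifold A i (bM i)) \<and>
     bM k = manifold_interior A k M \<and>
     (\<forall>i\<le>k. \<forall>x\<in>bM i. largest_subspace_of (support_cone A M x) (tangent_of A (bM i) x)) \<and>
     (\<forall>x\<in>M. convex (support_cone A M x) \<and> cone (support_cone A M x)) \<and>
     (\<forall>x\<in>M. locally_support_cone A M x)"

section \<open>Square integrable random variables\<close>

text \<open>The elements of \<open>L\<^sup>2\<close> are represented by random variables; all notions below are invariant
  under almost sure equality, and \<open>L2_norm P (\<lambda>\<omega>. X \<omega> - Y \<omega>) = 0\<close> expresses equality in \<open>L\<^sup>2\<close>.\<close>

definition L2 :: "'w measure \<Rightarrow> ('w \<Rightarrow> real) set" where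
  "L2 P = {X. X \<in> borel_measurable P \<and> integrable P (\<lambda>\<omega>. (X \<omega>)\<^sup>2)}"

definition L2_inner :: "'w measure \<Rightarrow> ('w \<Rightarrow> real) \<Rightarrow> ('w \<Rightarrow> real) \<Rightarrow> real" where
  "L2_inner P X Y = (\<integral>\<omega>. X \<omega> * Y \<omega> \<partial>P)"

definition L2_norm :: "'w measure \<Rightarrow> ('w \<Rightarrow> real) \<Rightarrow> real" where
  "L2_norm P X = sqrt (L2_inner P X X)"

definition cov :: "'w measure \<Rightarrow> ('w \<Rightarrow> real) \<Rightarrow> ('w \<Rightarrow> real) \<Rightarrow> real" where
  "cov P X Y = prob_space.expectation P
     (\<lambda>\<omega>. (X \<omega> - prob_space.expectation P X) * (Y \<omega> - prob_space.expectation P Y))"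

definition cor :: "'w measure \<Rightarrow> ('w \<Rightarrow> real) \<Rightarrow> ('w \<Rightarrow> real) \<Rightarrow> real" where
  "cor P X Y = cov P X Y / (sqrt (prob_space.variance P X) * sqrt (prob_space.variance P Y))"

definition L2_has_derivative ::
    "'w measure \<Rightarrow> ('e::euclidean_space \<Rightarrow> 'w \<Rightarrow> real) \<Rightarrow> ('e \<Rightarrow> 'w \<Rightarrow> real) \<Rightarrow> 'e \<Rightarrow> bool" where
  "L2_has_derivative P g D u \<longleftrightarrow>
     (\<forall>v. D v \<in> L2 P) \<and>
     (\<forall>v w. AE \<omega> in P. D (v + w) \<omega> = D v \<omega> + D w \<omega>) \<and>
     (\<forall>r v. AE \<omega> in P. D (r *\<^sub>R v) \<omega> = r * D v \<omega>) \<and>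
     ((\<lambda>h. L2_norm P (\<lambda>\<omega>. g (u + h) \<omega> - g u \<omega> - D h \<omega>) / norm h) \<longlongrightarrow> 0) (at 0)"

primrec L2_Ck_on ::
    "nat \<Rightarrow> 'w measure \<Rightarrow> ('e::euclidean_space \<Rightarrow> 'w \<Rightarrow> real) \<Rightarrow> 'e set \<Rightarrow> bool" where
  "L2_Ck_on 0 P g S \<longleftrightarrow> (\<forall>u\<in>S. g u \<in> L2 P) \<and>
     (\<forall>u\<in>S. ((\<lambda>w. L2_norm P (\<lambda>\<omega>. g w \<omega> - g u \<omega>)) \<longlongrightarrow> 0) (at u within S))"
| "L2_Ck_on (Suc n) P g S \<longleftrightarrow> (\<forall>u\<in>S. g u \<in> L2 P) \<and>
     (\<exists>D. (\<forall>u\<in>S. L2_has_derivative P g (D u) u) \<and> (\<forall>v. L2_Ck_on n P (\<lambda>u. D u v) S))"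

section \<open>Gaussian processes and the embedding into \<open>H\<^sub>f\<close>\<close>

text \<open>Constants are Gaussian (with variance zero).\<close>

definition gaussian_rv :: "'w measure \<Rightarrow> ('w \<Rightarrow> real) \<Rightarrow> bool" where
  "gaussian_rv P X \<longleftrightarrow> X \<in> borel_measurable P \<and>
     ((\<exists>\<mu> \<sigma>. \<sigma> > 0 \<and> distributed P lborel X (normal_density \<mu> \<sigma>)) \<or> (\<exists>\<mu>. AE \<omega> in P. X \<omega> = \<mu>))"

definition gaussian_process :: "'w measure \<Rightarrow> ('m \<Rightarrow> 'w \<Rightarrow> real) \<Rightarrow> bool" where
  "gaussian_process P f \<longleftrightarrow> prob_space P \<and>
     (\<forall>F c. finite F \<longrightarrow> gaussian_rv P (\<lambda>\<omega>. \<Sum>x\<in>F. c x * f x \<omega>))"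

definition centered_unit_variance :: "'w measure \<Rightarrow> ('m \<Rightarrow> 'w \<Rightarrow> real) \<Rightarrow> bool" where
  "centered_unit_variance P f \<longleftrightarrow>
     (\<forall>x. prob_space.expectation P (f x) = 0 \<and> prob_space.variance P (f x) = 1)"

text \<open>The closed linear span in \<open>L\<^sup>2\<close> of the variables of the process.\<close>

definition H_space :: "'w measure \<Rightarrow> ('m \<Rightarrow> 'w \<Rightarrow> real) \<Rightarrow> ('w \<Rightarrow> real) set" where
  "H_space P f = {X \<in> L2 P. \<forall>\<epsilon>>0. \<exists>F c. finite F \<and>
     L2_norm P (\<lambda>\<omega>. X \<omega> - (\<Sum>x\<in>F. c x * f x \<omega>)) < \<epsilon>}"

text \<open>\<open>dproc A P f x X\<close> is the derivative of the process at \<open>x\<close> along the tangent vector \<open>X\<close> at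
  \<open>x\<close>, i.e. the differential at \<open>x\<close> of \<open>x \<mapsto> f x \<in> L\<^sup>2\<close> applied to \<open>X\<close>. It is
  determined up to almost sure equality, and a version is selected.\<close>

definition dproc ::
    "('m, 'e::euclidean_space) chart set \<Rightarrow> 'w measure \<Rightarrow> ('m \<Rightarrow> 'w \<Rightarrow> real) \<Rightarrow> 'm \<Rightarrow> 'e \<Rightarrow> 'w \<Rightarrow> real" where
  "dproc A P f x =
     (SOME D. L2_has_derivative P (f \<circ> chart_inv (chart_at A x)) D (snd (chart_at A x) x))"

text \<open>\<open>x \<mapsto> f x\<close> is a \<open>C\<^sup>2\<close> immersion and a homeomorphism onto its image.\<close>

definition C2_embedding ::
    "('m::topological_space, 'e::euclidean_space) chart set \<Rightarrow> 'w measure \<Rightarrow> ('m \<Rightarrow> 'w \<Rightarrow> real) \<Rightarrow> bool" where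
  "C2_embedding A P f \<longleftrightarrow>
     (\<forall>x. f x \<in> H_space P f) \<and>
     (\<forall>c\<in>A. L2_Ck_on 2 P (f \<circ> chart_inv c) (snd c ` fst c)) \<and>
     (\<forall>x X. L2_norm P (dproc A P f x X) = 0 \<longrightarrow> X = 0) \<and>
     (\<forall>x y. L2_norm P (\<lambda>\<omega>. f x \<omega> - f y \<omega>) = 0 \<longrightarrow> x = y) \<and>
     (\<forall>x U. open U \<and> x \<in> U \<longrightarrow> (\<exists>\<epsilon>>0. \<forall>y. L2_norm P (\<lambda>\<omega>. f y \<omega> - f x \<omega>) < \<epsilon> \<longrightarrow> y \<in> U))"

section \<open>The process \<open>f\<^sup>x\<close>\<close>

text \<open>From here on \<open>f\<close> is the process on the whole ambient manifold.\<close>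

definition metric_g ::
    "('m, 'e::euclidean_space) chart set \<Rightarrow> 'w measure \<Rightarrow> ('m \<Rightarrow> 'w \<Rightarrow> real) \<Rightarrow> 'm \<Rightarrow> 'e \<Rightarrow> 'e \<Rightarrow> real" where
  "metric_g A P f x X Y = cov P (dproc A P f x X) (dproc A P f x Y)"

definition orthonormal_basis ::
    "('m, 'e::euclidean_space) chart set \<Rightarrow> 'w measure \<Rightarrow> ('m \<Rightarrow> 'w \<Rightarrow> real) \<Rightarrow> 'm \<Rightarrow> 'e set \<Rightarrow> bool" where
  "orthonormal_basis A P f x B \<longleftrightarrow> finite B \<and> span B = UNIV \<and>
     (\<forall>X\<in>B. \<forall>Y\<in>B. metric_g A P f x X Y = (if X = Y then 1 else 0))"

definition frame ::
    "('m, 'e::euclidean_space) chart set \<Rightarrow> 'w measure \<Rightarrow> ('m \<Rightarrow> 'w \<Rightarrow> real) \<Rightarrow> 'm \<Rightarrow> 'e set" where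
  "frame A P f x = (SOME B. orthonormal_basis A P f x B)"

definition normal_cone ::
    "('m::topological_space, 'e::euclidean_space) chart set \<Rightarrow> 'w measure \<Rightarrow> ('m \<Rightarrow> 'w \<Rightarrow> real) \<Rightarrow> 'm set \<Rightarrow> 'm \<Rightarrow> 'e set" where
  "normal_cone A P f M x = {X. \<forall>Y\<in>support_cone A M x. metric_g A P f x X Y \<le> 0}"

definition proj_normal ::
    "('m::topological_space, 'e::euclidean_space) chart set \<Rightarrow> 'w measure \<Rightarrow> ('m \<Rightarrow> 'w \<Rightarrow> real) \<Rightarrow> 'm set \<Rightarrow> 'm \<Rightarrow> 'e \<Rightarrow> 'e" where
  "proj_normal A P f M x X =
     (THE Z. Z \<in> normal_cone A P f M x \<and>
        (\<forall>W\<in>normal_cone A P f M x.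
           metric_g A P f x (X - Z) (X - Z) \<le> metric_g A P f x (X - W) (X - W)))"

definition F_field ::
    "('m, 'e::euclidean_space) chart set \<Rightarrow> 'w measure \<Rightarrow> ('m \<Rightarrow> 'w \<Rightarrow> real) \<Rightarrow> 'm \<Rightarrow> 'm \<Rightarrow> 'e" where
  "F_field A P f x y = (\<Sum>X\<in>frame A P f x. cov P (f y) (dproc A P f x X) *\<^sub>R X)"

definition F_hat ::
    "('m, 'e::euclidean_space) chart set \<Rightarrow> 'w measure \<Rightarrow> ('m \<Rightarrow> 'w \<Rightarrow> real) \<Rightarrow> 'm \<Rightarrow> 'm \<Rightarrow> 'e" where
  "F_hat A P f x y = F_field A P f x y - cor P (f x) (f y) *\<^sub>R F_field A P f x x"

definition gradient ::
    "('m, 'e::euclidean_space) chart set \<Rightarrow> 'w measure \<Rightarrow> ('m \<Rightarrow> 'w \<Rightarrow> real) \<Rightarrow> 'm \<Rightarrow> 'w \<Rightarrow> 'e" where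
  "gradient A P f x \<omega> = (\<Sum>X\<in>frame A P f x. dproc A P f x X \<omega> *\<^sub>R X)"

definition f_sup ::
    "('m::topological_space, 'e::euclidean_space) chart set \<Rightarrow> 'w measure \<Rightarrow> ('m \<Rightarrow> 'w \<Rightarrow> real) \<Rightarrow> 'm set \<Rightarrow> 'm \<Rightarrow> 'm \<Rightarrow> 'w \<Rightarrow> real" where
  "f_sup A P f M x y \<omega> =
     (f y \<omega> - cor P (f x) (f y) * f x \<omega>
       - metric_g A P f x (F_hat A P f x y - proj_normal A P f M x (F_hat A P f x y))
           (gradient A P f x \<omega>))
     / (1 - cor P (f x) (f y))"

definition critical_variance ::
    "('m::topological_space, 'e::euclidean_space) chart set \<Rightarrow> 'w measure \<Rightarrow> ('m \<Rightarrow> 'w \<Rightarrow> real) \<Rightarrow> 'm set \<Rightarrow> 'm \<Rightarrow> ennreal" where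
  "critical_variance A P f M x = (SUP y\<in>M - {x}. ennreal (prob_space.variance P (f_sup A P f M x y)))"

section \<open>The local critical radius\<close>

definition sphere_dist :: "'w measure \<Rightarrow> ('w \<Rightarrow> real) \<Rightarrow> ('w \<Rightarrow> real) \<Rightarrow> real" where
  "sphere_dist P a b = arccos (L2_inner P a b)"

definition sphere_geodesic :: "('w \<Rightarrow> real) \<Rightarrow> ('w \<Rightarrow> real) \<Rightarrow> real \<Rightarrow> 'w \<Rightarrow> real" where
  "sphere_geodesic p v t = (\<lambda>\<omega>. cos t * p \<omega> + sin t * v \<omega>)"

definition unique_closest :: "'w measure \<Rightarrow> ('w \<Rightarrow> real) set \<Rightarrow> ('w \<Rightarrow> real) \<Rightarrow> ('w \<Rightarrow> real) \<Rightarrow> bool" where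
  "unique_closest P K a p \<longleftrightarrow>
     (\<forall>b\<in>K. L2_norm P (\<lambda>\<omega>. b \<omega> - p \<omega>) \<noteq> 0 \<longrightarrow> sphere_dist P a p < sphere_dist P a b)"

definition critical_radius_dir ::
    "'w measure \<Rightarrow> ('w \<Rightarrow> real) set \<Rightarrow> ('w \<Rightarrow> real) \<Rightarrow> ('w \<Rightarrow> real) \<Rightarrow> real" where
  "critical_radius_dir P K p v =
     Sup {t. 0 \<le> t \<and> t < pi \<and> (\<forall>s\<in>{0..t}. unique_closest P K (sphere_geodesic p v s) p)}"

text \<open>Unit vectors of \<open>H\<^sub>f\<close> that are tangent to the unit sphere at \<open>f x\<close> (orthogonal to \<open>f x\<close>)
  and normal to the image of the top stratum \<open>N\<close>.\<close>

definition unit_normals ::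
    "('m::topological_space, 'e::euclidean_space) chart set \<Rightarrow> 'w measure \<Rightarrow> ('m \<Rightarrow> 'w \<Rightarrow> real) \<Rightarrow> 'm set \<Rightarrow> 'm \<Rightarrow> ('w \<Rightarrow> real) set" where
  "unit_normals A P f N x =
     {v \<in> H_space P f. L2_norm P v = 1 \<and> L2_inner P v (f x) = 0 \<and>
        (\<forall>X\<in>tangent_of A N x. L2_inner P v (dproc A P f x X) = 0)}"

text \<open>When there is no normal direction at all, the image is locally open in the unit sphere of
  \<open>H\<^sub>f\<close> and the infimum is over the empty set; it is then read as \<open>pi/2\<close>, the largest value the
  infimum can take otherwise (unless the image is a single point).\<close>

definition local_critical_radius ::
    "('m::topological_space, 'e::euclidean_space) chart set \<Rightarrow> 'w measure \<Rightarrow> ('m \<Rightarrow> 'w \<Rightarrow> real) \<Rightarrow> 'm set \<Rightarrow> 'm set \<Rightarrow> 'm \<Rightarrow> real" where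
  "local_critical_radius A P f M N x =
     (if unit_normals A P f N x = {} then pi / 2
      else Inf (critical_radius_dir P (f ` M) (f x) ` unit_normals A P f N x))"

end

theory Submission
  imports Defs
begin

text \<open>
  The variance of the process and the critical radius measure the same quantity. Let \<open>\<rho>\<close> be the
  correlation of \<open>f x\<close> and \<open>f y\<close>. As \<open>x\<close> lies in the top stratum, the support cone \<open>T\<close> at \<open>x\<close> is the
  tangent space of \<open>M\<close> (\<open>subspace_support_cone\<close>, \<open>tangent_eq_T\<close>), the normal cone is its orthogonal
  complement, and the numerator of \<open>f\<^sup>x(y)\<close> is the component \<open>n\<close> of \<open>f y\<close> orthogonal to \<open>f x\<close> and to
  all derivatives \<open>D X\<close> with \<open>X \<in> T\<close>. Hence the variance of \<open>f\<^sup>x(y)\<close> is \<open>(\<parallel>n\<parallel> / (1 - \<rho>))\<^sup>2\<close>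
  (\<open>variance_f_sup\<close>).

  On the other side, \<open>f x\<close> is closer than \<open>f y\<close> to the point at arc length \<open>s\<close>,
  \<open>0 < s < pi\<close>, of the geodesic in direction \<open>v\<close> exactly when \<open>\<langle>v, f y\<rangle> / (1 - \<rho>) < cot s\<close> (\<open>unique_closest_iff\<close>). For a unit normal
  \<open>v\<close> the inner product \<open>\<langle>v, f y\<rangle>\<close> equals \<open>\<langle>v, n\<rangle>\<close>; its largest value over all \<open>v\<close> is \<open>\<parallel>n\<parallel>\<close>, attained
  at the normalised \<open>n\<close>. Since \<open>cot\<close> is decreasing, the infimum over \<open>v\<close> of the local critical
  radii has cotangent \<open>sup \<parallel>n\<parallel> / (1 - \<rho>)\<close> (\<open>cot_Inf_Sup_angles\<close>).

  This last step needs the supremum to be finite (\<open>normal_part_quotient_bounded\<close>), and here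
  the smoothness of the embedding enters: near \<open>x\<close> the product \<open>\<langle>v, f y\<rangle>\<close> is at most a fixed multiple of
  \<open>1 - \<rho> = \<parallel>f y - f x\<parallel>\<^sup>2 / 2\<close> (\<open>second_order_contact\<close>), and away from \<open>x\<close> the latter is bounded
  below.
\<close>

section \<open>The semi-inner product of square integrable variables\<close>

lemma L2_mult_integrable:
  assumes "X \<in> L2 P" "Y \<in> L2 P"
  shows "integrable P (\<lambda>\<omega>. X \<omega> * Y \<omega>)"
proof (rule Bochner_Integration.integrable_bound)
  show "integrable P (\<lambda>\<omega>. (X \<omega>)\<^sup>2 + (Y \<omega>)\<^sup>2)"
    using assms by (simp add: L2_def)
  show "(\<lambda>\<omega>. X \<omega> * Y \<omega>) \<in> borel_measurable P"
    using assms by (auto simp: L2_def)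
  have "\<bar>a * b\<bar> \<le> a\<^sup>2 + b\<^sup>2" for a b :: real
  proof -
    have "0 \<le> (\<bar>a\<bar> - \<bar>b\<bar>)\<^sup>2" by simp
    then have "2 * (\<bar>a\<bar> * \<bar>b\<bar>) \<le> a\<^sup>2 + b\<^sup>2"
      by (simp add: power2_diff)
    moreover have "0 \<le> \<bar>a\<bar> * \<bar>b\<bar>" by simp
    ultimately show ?thesis by (simp only: abs_mult)
  qed
  then show "AE \<omega> in P. norm (X \<omega> * Y \<omega>) \<le> norm ((X \<omega>)\<^sup>2 + (Y \<omega>)\<^sup>2)"
    by (simp add: sum_power2_ge_zero)
qed

lemma L2_zero [simp]: "(\<lambda>\<omega>. 0) \<in> L2 P"
  by (simp add: L2_def)

lemma L2_add:
  assumes "X \<in> L2 P" "Y \<in> L2 P"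
  shows "(\<lambda>\<omega>. X \<omega> + Y \<omega>) \<in> L2 P"
proof -
  have "(\<lambda>\<omega>. (X \<omega> + Y \<omega>)\<^sup>2) = (\<lambda>\<omega>. (X \<omega>)\<^sup>2 + (Y \<omega>)\<^sup>2 + 2 * (X \<omega> * Y \<omega>))"
    by (auto simp: power2_sum)
  then show ?thesis
    using assms L2_mult_integrable[OF assms] by (auto simp: L2_def)
qed

lemma L2_scale: "X \<in> L2 P \<Longrightarrow> (\<lambda>\<omega>. r * X \<omega>) \<in> L2 P"
  by (auto simp: L2_def power_mult_distrib)

lemma L2_diff: "X \<in> L2 P \<Longrightarrow> Y \<in> L2 P \<Longrightarrow> (\<lambda>\<omega>. X \<omega> - Y \<omega>) \<in> L2 P"
  using L2_add[of X P "\<lambda>\<omega>. (-1) * Y \<omega>"] L2_scale[of Y P "-1"] by simp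

lemma L2_sum: "(\<And>i. i \<in> I \<Longrightarrow> X i \<in> L2 P) \<Longrightarrow> (\<lambda>\<omega>. \<Sum>i\<in>I. X i \<omega>) \<in> L2 P"
  by (induction I rule: infinite_finite_induct) (auto intro: L2_add)

lemmas L2_intros = L2_add L2_scale L2_diff L2_sum

lemma L2_inner_commute: "L2_inner P X Y = L2_inner P Y X"
  by (simp add: L2_inner_def mult.commute)

lemma L2_inner_add_right:
  assumes "Z \<in> L2 P" "X \<in> L2 P" "Y \<in> L2 P"
  shows "L2_inner P Z (\<lambda>\<omega>. X \<omega> + Y \<omega>) = L2_inner P Z X + L2_inner P Z Y"
  using assms by (simp add: L2_inner_def L2_mult_integrable distrib_left)

lemma L2_inner_scale_right: "L2_inner P Z (\<lambda>\<omega>. r * X \<omega>) = r * L2_inner P Z X"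
  by (simp add: L2_inner_def mult.left_commute)

lemma L2_inner_diff_right:
  assumes "Z \<in> L2 P" "X \<in> L2 P" "Y \<in> L2 P"
  shows "L2_inner P Z (\<lambda>\<omega>. X \<omega> - Y \<omega>) = L2_inner P Z X - L2_inner P Z Y"
  using assms by (simp add: L2_inner_def L2_mult_integrable right_diff_distrib)

lemma L2_inner_sum_right:
  assumes "Z \<in> L2 P" "\<And>i. i \<in> I \<Longrightarrow> X i \<in> L2 P"
  shows "L2_inner P Z (\<lambda>\<omega>. \<Sum>i\<in>I. X i \<omega>) = (\<Sum>i\<in>I. L2_inner P Z (X i))"
  using assms by (simp add: L2_inner_def L2_mult_integrable sum_distrib_left)

lemma L2_inner_add_left:
  assumes "Z \<in> L2 P" "X \<in> L2 P" "Y \<in> L2 P"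
  shows "L2_inner P (\<lambda>\<omega>. X \<omega> + Y \<omega>) Z = L2_inner P X Z + L2_inner P Y Z"
  using L2_inner_add_right[OF assms] by (simp add: L2_inner_commute)

lemma L2_inner_scale_left: "L2_inner P (\<lambda>\<omega>. r * X \<omega>) Z = r * L2_inner P X Z"
  by (metis L2_inner_commute L2_inner_scale_right)

lemma L2_inner_diff_left:
  assumes "Z \<in> L2 P" "X \<in> L2 P" "Y \<in> L2 P"
  shows "L2_inner P (\<lambda>\<omega>. X \<omega> - Y \<omega>) Z = L2_inner P X Z - L2_inner P Y Z"
  using L2_inner_diff_right[OF assms] by (simp add: L2_inner_commute)

lemma L2_inner_AE_cong_right:
  assumes "Z \<in> L2 P" "X \<in> L2 P" "Y \<in> L2 P" "AE \<omega> in P. X \<omega> = Y \<omega>"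
  shows "L2_inner P Z X = L2_inner P Z Y"
  unfolding L2_inner_def
  using assms by (intro integral_cong_AE) (auto simp: L2_def)

lemma L2_inner_nonneg: "0 \<le> L2_inner P X X"
  by (simp add: L2_inner_def)

lemma L2_norm_nonneg [simp]: "0 \<le> L2_norm P X"
  by (simp add: L2_norm_def L2_inner_nonneg)

lemma L2_norm_square: "(L2_norm P X)\<^sup>2 = L2_inner P X X"
  by (simp add: L2_norm_def L2_inner_nonneg)

lemma L2_norm_AE_cong:
  assumes "X \<in> L2 P" "Y \<in> L2 P" "AE \<omega> in P. X \<omega> = Y \<omega>"
  shows "L2_norm P X = L2_norm P Y"
  using L2_inner_AE_cong_right[OF assms(1,1,2,3)] L2_inner_AE_cong_right[OF assms(2,1,2,3)]
  by (simp add: L2_norm_def L2_inner_commute[of P X Y])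

lemma L2_norm_scale: "L2_norm P (\<lambda>\<omega>. r * X \<omega>) = \<bar>r\<bar> * L2_norm P X"
proof -
  have "L2_norm P (\<lambda>\<omega>. r * X \<omega>) = sqrt (r\<^sup>2 * L2_inner P X X)"
    by (simp add: L2_norm_def L2_inner_scale_left L2_inner_scale_right power2_eq_square mult.assoc)
  then show ?thesis
    by (simp add: L2_norm_def real_sqrt_mult)
qed

lemma L2_norm_minus_commute: "L2_norm P (\<lambda>\<omega>. X \<omega> - Y \<omega>) = L2_norm P (\<lambda>\<omega>. Y \<omega> - X \<omega>)"
  by (simp add: L2_norm_def L2_inner_def flip: power2_eq_square) (simp add: power2_commute)

lemma L2_norm_add_square:
  assumes "X \<in> L2 P" "Y \<in> L2 P"
  shows "(L2_norm P (\<lambda>\<omega>. X \<omega> + Y \<omega>))\<^sup>2 = (L2_norm P X)\<^sup>2 + 2 * L2_inner P X Y + (L2_norm P Y)\<^sup>2"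
  using assms
  by (simp add: L2_norm_square L2_inner_add_left L2_inner_add_right L2_intros
      L2_inner_commute[of P Y X])

lemma L2_norm_diff_square:
  assumes "X \<in> L2 P" "Y \<in> L2 P"
  shows "(L2_norm P (\<lambda>\<omega>. X \<omega> - Y \<omega>))\<^sup>2 = (L2_norm P X)\<^sup>2 - 2 * L2_inner P X Y + (L2_norm P Y)\<^sup>2"
  using assms
  by (simp add: L2_norm_square L2_inner_diff_left L2_inner_diff_right L2_intros
      L2_inner_commute[of P Y X])

text \<open>The discriminant of the nonnegative quadratic polynomial \<open>t \<mapsto> \<parallel>X + t Y\<parallel>\<^sup>2\<close>; a null variable
  \<open>Y\<close> makes it affine, and then its slope vanishes.\<close>

lemma L2_Cauchy_Schwarz:
  assumes X: "X \<in> L2 P" and Y: "Y \<in> L2 P"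
  shows "\<bar>L2_inner P X Y\<bar> \<le> L2_norm P X * L2_norm P Y"
proof -
  define a b c where "a = L2_inner P X X" and "b = L2_inner P X Y" and "c = L2_inner P Y Y"
  have q: "0 \<le> a + 2 * t * b + t\<^sup>2 * c" for t
  proof -
    have "0 \<le> (L2_norm P (\<lambda>\<omega>. X \<omega> + t * Y \<omega>))\<^sup>2" by simp
    also have "\<dots> = a + 2 * t * b + t\<^sup>2 * c"
      using X Y by (subst L2_norm_add_square)
        (auto simp: L2_scale L2_norm_scale power_mult_distrib L2_norm_square
          L2_inner_scale_right a_def b_def c_def)
    finally show ?thesis .
  qed
  have "0 \<le> a" "0 \<le> c"
    by (simp_all add: a_def c_def L2_inner_nonneg)
  have "b\<^sup>2 \<le> a * c"
  proof (cases "c = 0")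
    case True
    have "b = 0"
    proof (rule ccontr)
      assume "b \<noteq> 0"
      then show False
        using q[of "- (a + 1) / (2 * b)"] True by (simp add: field_simps)
    qed
    then show ?thesis using True by simp
  next
    case False
    then have "0 < c" using \<open>0 \<le> c\<close> by simp
    then show ?thesis
      using q[of "- b / c"] by (simp add: field_simps power2_eq_square)
  qed
  then have "sqrt (b\<^sup>2) \<le> sqrt (a * c)"
    by (rule real_sqrt_le_mono)
  then show ?thesis
    by (simp add: L2_norm_def real_sqrt_mult a_def b_def c_def)
qed

lemma L2_norm_triangle:
  assumes "X \<in> L2 P" "Y \<in> L2 P"
  shows "L2_norm P (\<lambda>\<omega>. X \<omega> + Y \<omega>) \<le> L2_norm P X + L2_norm P Y"
proof (rule power2_le_imp_le)
  show "(L2_norm P (\<lambda>\<omega>. X \<omega> + Y \<omega>))\<^sup>2 \<le> (L2_norm P X + L2_norm P Y)\<^sup>2"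
    using L2_Cauchy_Schwarz[OF assms] L2_norm_add_square[OF assms]
    by (simp add: power2_sum)
qed simp

lemma L2_norm_diff_triangle:
  assumes "X \<in> L2 P" "Y \<in> L2 P" "Z \<in> L2 P"
  shows "L2_norm P (\<lambda>\<omega>. X \<omega> - Z \<omega>) \<le> L2_norm P (\<lambda>\<omega>. X \<omega> - Y \<omega>) + L2_norm P (\<lambda>\<omega>. Y \<omega> - Z \<omega>)"
  using L2_norm_triangle[of "\<lambda>\<omega>. X \<omega> - Y \<omega>" P "\<lambda>\<omega>. Y \<omega> - Z \<omega>"] assms by (simp add: L2_diff)

section \<open>Positive definite forms on a Euclidean space\<close>

locale positive_definite_form =
  fixes g :: "'e::euclidean_space \<Rightarrow> 'e \<Rightarrow> real"
  assumes bilinear: "bilinear g"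
    and symmetric: "g X Y = g Y X"
    and positive: "X \<noteq> 0 \<Longrightarrow> 0 < g X X"
begin

definition orthonormal :: "'e set \<Rightarrow> bool" where
  "orthonormal B \<longleftrightarrow> finite B \<and> (\<forall>X\<in>B. \<forall>Y\<in>B. g X Y = (if X = Y then 1 else 0))"

lemma linear_left: "linear (\<lambda>X. g X Y)" and linear_right: "linear (g X)"
  using bilinear by (simp_all add: bilinear_def)

lemma nonneg: "0 \<le> g X X"
  using positive[of X] linear_0[OF linear_right] by (cases "X = 0") auto

lemma orthonormal_expansion_coeff:
  assumes "orthonormal B" "Y \<in> B"
  shows "g (\<Sum>X\<in>B. c X *\<^sub>R X) Y = c Y"
proof -
  have "g (\<Sum>X\<in>B. c X *\<^sub>R X) Y = (\<Sum>X\<in>B. c X * g X Y)"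
    by (simp add: linear_sum[OF linear_left] linear_scale[OF linear_left])
  also have "\<dots> = (\<Sum>X\<in>B. if X = Y then c X else 0)"
    using assms by (intro sum.cong) (auto simp: orthonormal_def)
  also have "\<dots> = c Y"
    using assms by (simp add: orthonormal_def)
  finally show ?thesis .
qed

lemma orthonormal_card_le:
  assumes "orthonormal B"
  shows "card B \<le> DIM('e)"
proof -
  have "finite B" using assms by (simp add: orthonormal_def)
  have "independent B"
  proof (rule independent_if_scalars_zero[OF \<open>finite B\<close>])
    fix c Y assume "(\<Sum>X\<in>B. c X *\<^sub>R X) = 0" "Y \<in> B"
    then show "c Y = 0"
      using orthonormal_expansion_coeff[OF assms, of Y c] linear_0[OF linear_left] by simp
  qed
  then show ?thesis
    using independent_bound by blast
qed

text \<open>An orthonormal subset of largest cardinality spans: otherwise the normalised remainder of a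
  vector outside the span could be added to it.\<close>

lemma orthonormal_basis_exists:
  assumes S: "subspace S"
  shows "\<exists>B. orthonormal B \<and> B \<subseteq> S \<and> span B = S"
proof -
  let ?Q = "\<lambda>B. orthonormal B \<and> B \<subseteq> S"
  have "?Q {}" by (simp add: orthonormal_def)
  moreover have "\<forall>B. ?Q B \<longrightarrow> card B < Suc (DIM('e))"
    using orthonormal_card_le by (simp add: less_Suc_eq_le)
  ultimately obtain B where B: "?Q B" and max: "\<And>C. ?Q C \<Longrightarrow> card C \<le> card B"
    using ex_has_greatest_nat[of ?Q "{}" card "Suc (DIM('e))"] by blast
  have fin: "finite B" using B by (simp add: orthonormal_def)
  have "span B = S"
  proof (rule ccontr)
    assume "span B \<noteq> S"
    moreover have "span B \<subseteq> S" using B S by (simp add: span_minimal)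
    ultimately obtain v where v: "v \<in> S" "v \<notin> span B" by blast
    define p where "p = (\<Sum>X\<in>B. g v X *\<^sub>R X)"
    define b where "b = v - p"
    have p: "p \<in> span B"
      unfolding p_def by (intro span_sum span_scale span_base)
    have "b \<noteq> 0" using v p by (auto simp: b_def)
    have "b \<in> S" using v p B S by (metis b_def \<open>span B \<subseteq> S\<close> subsetD subspace_diff)
    have orth: "g b Y = 0" if "Y \<in> B" for Y
      using orthonormal_expansion_coeff[of B Y "g v"] B that
      by (simp add: b_def p_def linear_diff[OF linear_left])
    have pos: "0 < g b b" using \<open>b \<noteq> 0\<close> by (rule positive)
    define e where "e = (1 / sqrt (g b b)) *\<^sub>R b"
    have "e \<in> S" using \<open>b \<in> S\<close> S by (simp add: e_def subspace_scale)
    have e_orth: "g e Y = 0" "g Y e = 0" if "Y \<in> B" for Y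
      using orth[OF that] by (simp_all add: e_def linear_scale[OF linear_left] symmetric[of Y])
    have e_unit: "g e e = 1"
      using pos by (simp add: e_def linear_scale[OF linear_left] linear_scale[OF linear_right])
    have "e \<notin> B" using e_unit e_orth by force
    have "?Q (insert e B)"
      using B \<open>e \<in> S\<close> e_orth e_unit \<open>e \<notin> B\<close> by (auto simp: orthonormal_def)
    then have "card (insert e B) \<le> card B" by (rule max)
    then show False using \<open>e \<notin> B\<close> fin by simp
  qed
  then show ?thesis using B by blast
qed

lemma orthonormal_expansion:
  assumes "orthonormal B" "span B = S" "X \<in> S"
  shows "X = (\<Sum>Y\<in>B. g X Y *\<^sub>R Y)"
proof -
  have "finite B" using assms by (simp add: orthonormal_def)
  then obtain c where c: "X = (\<Sum>Y\<in>B. c Y *\<^sub>R Y)"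
    using assms span_finite[of B] by auto
  then have "g X Y = c Y" if "Y \<in> B" for Y
    using orthonormal_expansion_coeff[OF assms(1) that] by simp
  then show ?thesis using c by simp
qed

lemma orthogonal_decomposition:
  assumes S: "subspace S"
  obtains a b where "X = a + b" "a \<in> S" "\<And>Y. Y \<in> S \<Longrightarrow> g b Y = 0"
proof -
  obtain B where B: "orthonormal B" "span B = S"
    using orthonormal_basis_exists[OF S] by blast
  define a where "a = (\<Sum>Y\<in>B. g X Y *\<^sub>R Y)"
  have a: "a \<in> S"
    unfolding a_def B(2)[symmetric] by (intro span_sum span_scale span_base)
  have on_B: "g (X - a) Y = 0" if "Y \<in> B" for Y
    using orthonormal_expansion_coeff[OF B(1) that, of "g X"]
    by (simp add: linear_diff[OF linear_left] a_def)
  have "g (X - a) Y = 0" if "Y \<in> S" for Y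
    using linear_eq_0_on_span[OF linear_right on_B] that B(2) by blast
  with a show ?thesis by (intro that[of a "X - a"]) auto
qed

text \<open>By Pythagoras, the nearest point in the orthogonal complement is the orthogonal component.\<close>

lemma nearest_point_orthogonal_complement:
  assumes a: "a \<in> S" and b: "\<And>Y. Y \<in> S \<Longrightarrow> g b Y = 0"
  shows "(THE Z. Z \<in> {Z. \<forall>Y\<in>S. g Z Y = 0} \<and>
      (\<forall>W\<in>{Z. \<forall>Y\<in>S. g Z Y = 0}. g (a + b - Z) (a + b - Z) \<le> g (a + b - W) (a + b - W))) = b"
proof (rule the_equality)
  have pyth: "g (a + b - W) (a + b - W) = g a a + g (b - W) (b - W)" if "\<forall>Y\<in>S. g W Y = 0" for W
  proof -
    have "g (b - W) a = 0"
      using a b that by (simp add: linear_diff[OF linear_left])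
    moreover have "g a (b - W) = g (b - W) a" by (rule symmetric)
    moreover have "g (a + (b - W)) (a + (b - W)) = g a a + g (b - W) a + (g a (b - W) + g (b - W) (b - W))"
      unfolding linear_add[OF linear_left] linear_add[OF linear_right] by simp
    ultimately show ?thesis by (simp add: add_diff_eq)
  qed
  show "b \<in> {Z. \<forall>Y\<in>S. g Z Y = 0} \<and>
      (\<forall>W\<in>{Z. \<forall>Y\<in>S. g Z Y = 0}. g (a + b - b) (a + b - b) \<le> g (a + b - W) (a + b - W))"
    using b pyth nonneg by auto
  fix Z assume Z: "Z \<in> {Z. \<forall>Y\<in>S. g Z Y = 0} \<and>
      (\<forall>W\<in>{Z. \<forall>Y\<in>S. g Z Y = 0}. g (a + b - Z) (a + b - Z) \<le> g (a + b - W) (a + b - W))"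
  then have "g (a + b - Z) (a + b - Z) \<le> g (a + b - b) (a + b - b)"
    using b by blast
  then have "g (b - Z) (b - Z) \<le> 0"
    using pyth[of Z] Z by simp
  then show "Z = b"
    using positive[of "b - Z"] by fastforce
qed

end

section \<open>Differentiation in the mean square\<close>

text \<open>Derivatives in the mean square are determined only almost surely, and so is their linearity. It
  becomes genuine linearity after taking the inner product with a fixed variable.\<close>

definition L2_linear :: "'w measure \<Rightarrow> ('e::euclidean_space \<Rightarrow> 'w \<Rightarrow> real) \<Rightarrow> bool" where
  "L2_linear P D \<longleftrightarrow> (\<forall>v. D v \<in> L2 P) \<and>
     (\<forall>v w. AE \<omega> in P. D (v + w) \<omega> = D v \<omega> + D w \<omega>) \<and>
     (\<forall>r v. AE \<omega> in P. D (r *\<^sub>R v) \<omega> = r * D v \<omega>)"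

lemma L2_has_derivative_linear: "L2_has_derivative P G D u \<Longrightarrow> L2_linear P D"
  by (simp add: L2_has_derivative_def L2_linear_def)

lemma linear_L2_inner:
  assumes "L2_linear P D" "Z \<in> L2 P"
  shows "linear (\<lambda>v. L2_inner P Z (D v))"
proof (rule linearI)
  fix v w r
  have "L2_inner P Z (D (v + w)) = L2_inner P Z (\<lambda>\<omega>. D v \<omega> + D w \<omega>)"
    using assms by (intro L2_inner_AE_cong_right) (auto simp: L2_linear_def L2_add)
  then show "L2_inner P Z (D (v + w)) = L2_inner P Z (D v) + L2_inner P Z (D w)"
    using assms by (simp add: L2_linear_def L2_inner_add_right)
  have "L2_inner P Z (D (r *\<^sub>R v)) = L2_inner P Z (\<lambda>\<omega>. r * D v \<omega>)"
    using assms by (intro L2_inner_AE_cong_right) (auto simp: L2_linear_def L2_scale)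
  then show "L2_inner P Z (D (r *\<^sub>R v)) = r *\<^sub>R L2_inner P Z (D v)"
    by (simp add: L2_inner_scale_right)
qed

lemma bilinear_L2_inner:
  assumes "L2_linear P D"
  shows "bilinear (\<lambda>v w. L2_inner P (D v) (D w))"
  unfolding bilinear_def
proof (intro conjI allI)
  have DL: "D v \<in> L2 P" for v using assms by (simp add: L2_linear_def)
  show "linear (\<lambda>w. L2_inner P (D v) (D w))" for v
    using assms DL by (rule linear_L2_inner)
  show "linear (\<lambda>v. L2_inner P (D v) (D w))" for w
    using linear_L2_inner[OF assms DL[of w]] by (subst L2_inner_commute)
qed

lemma L2_linear_bounded:
  assumes "L2_linear P D"
  obtains C where "0 < C" "\<And>v. L2_norm P (D v) \<le> C * norm v"
proof -
  obtain K where K: "0 < K" "\<And>v w. norm (L2_inner P (D v) (D w)) \<le> norm v * norm w * K"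
    using bilinear_L2_inner[OF assms] bilinear_conv_bounded_bilinear bounded_bilinear.pos_bounded
    by (metis (lifting))
  have "L2_norm P (D v) \<le> sqrt K * norm v" for v
  proof (rule power2_le_imp_le)
    show "(L2_norm P (D v))\<^sup>2 \<le> (sqrt K * norm v)\<^sup>2"
      using K(2)[of v v] K(1)
      by (simp add: L2_norm_square power_mult_distrib) (simp add: power2_eq_square ac_simps)
  qed (use K(1) in simp)
  then show ?thesis using K(1) by (intro that[of "sqrt K"]) auto
qed

text \<open>The quadratic form \<open>\<parallel>D v\<parallel>\<^sup>2\<close> attains a positive minimum on the compact unit sphere.\<close>

lemma L2_linear_bounded_below:
  fixes D :: "'e::euclidean_space \<Rightarrow> 'w \<Rightarrow> real"
  assumes lin: "L2_linear P D" and inj: "\<And>v. L2_norm P (D v) = 0 \<Longrightarrow> v = 0"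
  obtains c where "0 < c" "\<And>v. c * norm v \<le> L2_norm P (D v)"
proof -
  have "bounded_bilinear (\<lambda>v w. L2_inner P (D v) (D w))"
    using bilinear_L2_inner[OF lin] bilinear_conv_bounded_bilinear by blast
  then have "continuous_on (sphere 0 1) (\<lambda>v. L2_inner P (D v) (D v))"
    by (rule bounded_bilinear.continuous_on) (rule continuous_on_id)+
  then have cont: "continuous_on (sphere 0 1) (\<lambda>v. sqrt (L2_inner P (D v) (D v)))"
    by (rule continuous_on_real_sqrt)
  obtain b :: 'e where "b \<in> Basis" using nonempty_Basis by blast
  then have "sphere (0::'e) 1 \<noteq> {}" by (auto intro!: exI[of _ b])
  then obtain w :: 'e where w: "norm w = 1" "\<And>v. norm v = 1 \<Longrightarrow> L2_norm P (D w) \<le> L2_norm P (D v)"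
    using continuous_attains_inf[OF compact_sphere _ cont] by (auto simp: L2_norm_def)
  define c where "c = L2_norm P (D w)"
  have "c \<noteq> 0" using inj[of w] w(1) by (auto simp: c_def)
  then have "0 < c" using L2_norm_nonneg[of P "D w"] unfolding c_def by linarith
  moreover have "c * norm v \<le> L2_norm P (D v)" for v
  proof (cases "v = 0")
    case False
    define s where "s = (1 / norm v) *\<^sub>R v"
    have v: "v = norm v *\<^sub>R s" using False by (simp add: s_def)
    have DL: "\<And>v. D v \<in> L2 P" using lin by (simp add: L2_linear_def)
    have "linear (\<lambda>v. L2_inner P (D v) (D w))" for w
      using bilinear_L2_inner[OF lin] by (simp add: bilinear_def)
    then have "L2_inner P (D (norm v *\<^sub>R s)) (D (norm v *\<^sub>R s)) = norm v * (norm v * L2_inner P (D s) (D s))"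
      using linear_scale[OF linear_L2_inner[OF lin DL], of s "norm v" s]
        linear_scale[of "\<lambda>x. L2_inner P (D x) (D (norm v *\<^sub>R s))" "norm v" s] by simp
    then have "L2_norm P (D v) = norm v * L2_norm P (D s)"
      by (subst v) (simp add: L2_norm_def real_sqrt_mult)
    moreover have "c \<le> L2_norm P (D s)" unfolding c_def using False by (intro w(2)) (simp add: s_def)
    ultimately show ?thesis by (metis mult.commute mult_left_mono norm_ge_zero)
  qed simp
  ultimately show ?thesis by (rule that)
qed

lemma L2_has_derivative_approx:
  assumes der: "L2_has_derivative P G D u" and "0 < e"
  obtains d where "0 < d"
    "\<And>z. norm (z - u) < d \<Longrightarrow> L2_norm P (\<lambda>\<omega>. G z \<omega> - G u \<omega> - D (z - u) \<omega>) \<le> e * norm (z - u)"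
proof -
  let ?R = "\<lambda>h. L2_norm P (\<lambda>\<omega>. G (u + h) \<omega> - G u \<omega> - D h \<omega>)"
  have "((\<lambda>h. ?R h / norm h) \<longlongrightarrow> 0) (at 0)"
    using der by (simp add: L2_has_derivative_def)
  then obtain d where d: "0 < d" "\<And>h. h \<noteq> 0 \<Longrightarrow> norm h < d \<Longrightarrow> \<bar>?R h / norm h\<bar> < e"
    using LIM_D[of _ 0 0 e] \<open>0 < e\<close> by fastforce
  obtain C where "\<And>v. L2_norm P (D v) \<le> C * norm v"
    using L2_linear_bounded[OF L2_has_derivative_linear[OF der]] by blast
  from this[of 0] have D0: "L2_norm P (D 0) = 0"
    using L2_norm_nonneg[of P "D 0"] by simp
  have "?R h \<le> e * norm h" if "norm h < d" for h
  proof (cases "h = 0")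
    case True
    then show ?thesis using D0 L2_norm_scale[of P "-1" "D 0"] by simp
  next
    case False
    then show ?thesis using d(2)[OF False that] by (simp add: field_simps)
  qed
  have "L2_norm P (\<lambda>\<omega>. G z \<omega> - G u \<omega> - D (z - u) \<omega>) \<le> e * norm (z - u)"
    if "norm (z - u) < d" for z
    using \<open>\<And>h. norm h < d \<Longrightarrow> ?R h \<le> e * norm h\<close>[OF that] by simp
  with d(1) show ?thesis by (rule that)
qed

lemma L2_has_derivative_Lipschitz:
  assumes der: "L2_has_derivative P G D u" and Gu: "G u \<in> L2 P"
  obtains C d where "0 < C" "0 < d"
    "\<And>z. norm (z - u) < d \<Longrightarrow> G z \<in> L2 P \<Longrightarrow> L2_norm P (\<lambda>\<omega>. G z \<omega> - G u \<omega>) \<le> C * norm (z - u)"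
proof -
  have lin: "L2_linear P D" using der by (rule L2_has_derivative_linear)
  obtain C where C: "0 < C" "\<And>v. L2_norm P (D v) \<le> C * norm v"
    using L2_linear_bounded[OF lin] by blast
  obtain d where d: "0 < d" "\<And>z. norm (z - u) < d \<Longrightarrow>
      L2_norm P (\<lambda>\<omega>. G z \<omega> - G u \<omega> - D (z - u) \<omega>) \<le> 1 * norm (z - u)"
    using L2_has_derivative_approx[OF der zero_less_one] by blast
  have "L2_norm P (\<lambda>\<omega>. G z \<omega> - G u \<omega>) \<le> (1 + C) * norm (z - u)"
    if "norm (z - u) < d" "G z \<in> L2 P" for z
  proof -
    have "D (z - u) \<in> L2 P" using lin by (simp add: L2_linear_def)
    then have "L2_norm P (\<lambda>\<omega>. G z \<omega> - G u \<omega>)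
        \<le> L2_norm P (\<lambda>\<omega>. G z \<omega> - G u \<omega> - D (z - u) \<omega>) + L2_norm P (D (z - u))"
      using L2_norm_triangle[of "\<lambda>\<omega>. G z \<omega> - G u \<omega> - D (z - u) \<omega>" P "D (z - u)"] that Gu
      by (simp add: L2_diff)
    then show ?thesis using d(2)[OF that(1)] C(2)[of "z - u"] by (simp add: algebra_simps)
  qed
  then show ?thesis using C(1) d(1) by (intro that[of "1 + C" d]) auto
qed

lemma L2_has_derivative_expanding:
  fixes D :: "'e::euclidean_space \<Rightarrow> 'w \<Rightarrow> real"
  assumes der: "L2_has_derivative P G D u" and inj: "\<And>v. L2_norm P (D v) = 0 \<Longrightarrow> v = 0"
    and Gu: "G u \<in> L2 P"
  obtains c d where "0 < c" "0 < d"
    "\<And>z. norm (z - u) < d \<Longrightarrow> G z \<in> L2 P \<Longrightarrow> c * norm (z - u) \<le> L2_norm P (\<lambda>\<omega>. G z \<omega> - G u \<omega>)"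
proof -
  have lin: "L2_linear P D" using der by (rule L2_has_derivative_linear)
  obtain c where c: "0 < c" "\<And>v. c * norm v \<le> L2_norm P (D v)"
    using L2_linear_bounded_below[OF lin inj] by blast
  then have "0 < c / 2" by simp
  then obtain d where d: "0 < d" "\<And>z. norm (z - u) < d \<Longrightarrow>
      L2_norm P (\<lambda>\<omega>. G z \<omega> - G u \<omega> - D (z - u) \<omega>) \<le> c / 2 * norm (z - u)"
    using L2_has_derivative_approx[OF der] by blast
  have "c / 2 * norm (z - u) \<le> L2_norm P (\<lambda>\<omega>. G z \<omega> - G u \<omega>)"
    if "norm (z - u) < d" "G z \<in> L2 P" for z
  proof -
    have DL: "D (z - u) \<in> L2 P" using lin by (simp add: L2_linear_def)
    let ?X = "\<lambda>\<omega>. G z \<omega> - G u \<omega>"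
    have "L2_norm P (D (z - u)) \<le> L2_norm P (\<lambda>\<omega>. D (z - u) \<omega> - ?X \<omega>) + L2_norm P ?X"
      using L2_norm_triangle[of "\<lambda>\<omega>. D (z - u) \<omega> - ?X \<omega>" P ?X] that Gu DL by (simp add: L2_diff)
    also have "L2_norm P (\<lambda>\<omega>. D (z - u) \<omega> - ?X \<omega>) \<le> c / 2 * norm (z - u)"
      using d(2)[OF that(1)] by (subst L2_norm_minus_commute) simp
    finally show ?thesis using c(2)[of "z - u"] by simp
  qed
  then show ?thesis using \<open>0 < c / 2\<close> d(1) by (intro that[of "c / 2" d]) auto
qed

lemma L2_has_derivative_inner:
  assumes der: "L2_has_derivative P G D u" and G: "\<And>z. G z \<in> L2 P" and Z: "Z \<in> L2 P"
  shows "((\<lambda>z. L2_inner P Z (G z)) has_derivative (\<lambda>h. L2_inner P Z (D h))) (at u)"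
  unfolding has_derivative_at_alt
proof (intro conjI allI impI)
  have lin: "L2_linear P D" using der by (rule L2_has_derivative_linear)
  show "bounded_linear (\<lambda>h. L2_inner P Z (D h))"
    using linear_L2_inner[OF lin Z] by (simp add: linear_conv_bounded_linear)
  fix e :: real assume "0 < e"
  define K where "K = L2_norm P Z + 1"
  have K: "0 < K" "L2_norm P Z \<le> K"
    using L2_norm_nonneg[of P Z] by (auto simp: K_def add_nonneg_pos simp del: L2_norm_nonneg)
  then obtain d where d: "0 < d" "\<And>z. norm (z - u) < d \<Longrightarrow>
      L2_norm P (\<lambda>\<omega>. G z \<omega> - G u \<omega> - D (z - u) \<omega>) \<le> e / K * norm (z - u)"
    using L2_has_derivative_approx[OF der, of "e / K"] \<open>0 < e\<close> by auto
  have "norm (L2_inner P Z (G z) - L2_inner P Z (G u) - L2_inner P Z (D (z - u))) \<le> e * norm (z - u)"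
    if "norm (z - u) < d" for z
  proof -
    have DL: "D (z - u) \<in> L2 P" using lin by (simp add: L2_linear_def)
    have "norm (L2_inner P Z (G z) - L2_inner P Z (G u) - L2_inner P Z (D (z - u)))
        = \<bar>L2_inner P Z (\<lambda>\<omega>. G z \<omega> - G u \<omega> - D (z - u) \<omega>)\<bar>"
      using G Z DL by (simp add: L2_inner_diff_right L2_diff)
    also have "\<dots> \<le> L2_norm P Z * L2_norm P (\<lambda>\<omega>. G z \<omega> - G u \<omega> - D (z - u) \<omega>)"
      using G Z DL by (intro L2_Cauchy_Schwarz L2_diff)
    also have "\<dots> \<le> K * (e / K * norm (z - u))"
      using d(2)[OF that] K by (intro mult_mono) auto
    finally show ?thesis using K by simp
  qed
  with d(1) show "\<exists>d>0. \<forall>z. norm (z - u) < d \<longrightarrow>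
      norm (L2_inner P Z (G z) - L2_inner P Z (G u) - L2_inner P Z (D (z - u))) \<le> e * norm (z - u)"
    by blast
qed

lemma has_derivative_Lipschitz:
  assumes "(G has_derivative G') (at u)"
  obtains C d where "0 < C" "0 < d" "\<And>z. norm (z - u) < d \<Longrightarrow> norm (G z - G u) \<le> C * norm (z - u)"
proof -
  have lin: "bounded_linear G'" using assms by (rule has_derivative_bounded_linear)
  obtain C where C: "0 < C" "\<And>v. norm (G' v) \<le> norm v * C"
    using bounded_linear.pos_bounded[OF lin] by blast
  obtain d where d: "0 < d" "\<And>z. norm (z - u) < d \<Longrightarrow> norm (G z - G u - G' (z - u)) \<le> 1 * norm (z - u)"
    using assms zero_less_one unfolding has_derivative_at_alt by blast
  have "norm (G z - G u) \<le> (1 + C) * norm (z - u)" if "norm (z - u) < d" for z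
    using d(2)[OF that] C(2)[of "z - u"] norm_triangle_ineq[of "G z - G u - G' (z - u)" "G' (z - u)"]
    by (simp add: algebra_simps)
  then show ?thesis using C(1) d(1) by (intro that[of "1 + C" d]) auto
qed

text \<open>If the partial derivatives are differentiable at \<open>z0\<close>, they are Lipschitz there, hence so is
  the differential. Testing against a variable \<open>Z\<close> keeps the almost sure linearity of \<open>D z\<close> out of
  the statement.\<close>

lemma L2_derivative_Lipschitz:
  fixes D :: "'e::euclidean_space \<Rightarrow> 'e \<Rightarrow> 'w \<Rightarrow> real"
  assumes "open W" "z0 \<in> W"
    and lin: "\<And>z. z \<in> W \<Longrightarrow> L2_linear P (D z)"
    and der: "\<And>v. \<exists>E. L2_has_derivative P (\<lambda>z. D z v) E z0"
  obtains C d where "0 < C" "0 < d"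
    "\<And>z v Z. norm (z - z0) < d \<Longrightarrow> Z \<in> L2 P \<Longrightarrow>
      z \<in> W \<and> \<bar>L2_inner P Z (D z v) - L2_inner P Z (D z0 v)\<bar> \<le> C * norm (z - z0) * norm v * L2_norm P Z"
proof -
  have DL: "D z v \<in> L2 P" if "z \<in> W" for z v
    using lin[OF that] by (simp add: L2_linear_def)
  have "\<exists>C d. 0 < C \<and> 0 < d \<and> (\<forall>z. norm (z - z0) < d \<longrightarrow> D z b \<in> L2 P \<longrightarrow>
      L2_norm P (\<lambda>\<omega>. D z b \<omega> - D z0 b \<omega>) \<le> C * norm (z - z0))" for b
  proof -
    obtain E where "L2_has_derivative P (\<lambda>z. D z b) E z0" using der by blast
    then show ?thesis
      using L2_has_derivative_Lipschitz[of P "\<lambda>z. D z b" E z0] DL[OF \<open>z0 \<in> W\<close>, of b] by blast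
  qed
  then obtain C d where C: "\<And>b. 0 < C b" and d: "\<And>b. 0 < d b"
    and Lip: "\<And>b z. norm (z - z0) < d b \<Longrightarrow> D z b \<in> L2 P \<Longrightarrow>
      L2_norm P (\<lambda>\<omega>. D z b \<omega> - D z0 b \<omega>) \<le> C b * norm (z - z0)"
    by metis
  obtain d0 where d0: "0 < d0" "ball z0 d0 \<subseteq> W"
    using assms(1,2) by (meson open_contains_ball)
  define \<delta> where "\<delta> = Min (insert d0 (d ` Basis))"
  have "0 < \<delta>" using d0 d by (simp add: \<delta>_def)
  moreover have "\<delta> \<le> d0" "\<And>b. b \<in> Basis \<Longrightarrow> \<delta> \<le> d b"
    unfolding \<delta>_def by (intro Min_le; simp)+
  ultimately have \<delta>: "0 < \<delta>" "\<delta> \<le> d0" "\<And>b. b \<in> Basis \<Longrightarrow> \<delta> \<le> d b"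
    by auto
  define K where "K = sum C Basis"
  have "0 < K" unfolding K_def using C by (intro sum_pos) auto
  have "z \<in> W \<and> \<bar>L2_inner P Z (D z v) - L2_inner P Z (D z0 v)\<bar> \<le> K * norm (z - z0) * norm v * L2_norm P Z"
    if z: "norm (z - z0) < \<delta>" and Z: "Z \<in> L2 P" for z v Z
  proof
    have "z \<in> ball z0 d0" using z \<delta>(2) by (simp add: dist_norm norm_minus_commute)
    then show zW: "z \<in> W" using d0 by blast
    have expand: "L2_inner P Z (D y v) = (\<Sum>b\<in>Basis. (v \<bullet> b) * L2_inner P Z (D y b))" if "y \<in> W" for y
    proof -
      have linZ: "linear (\<lambda>w. L2_inner P Z (D y w))"
        using lin[OF that] Z by (rule linear_L2_inner)
      show ?thesis
        using linear_sum[OF linZ, of "\<lambda>b. (v \<bullet> b) *\<^sub>R b" Basis] linear_scale[OF linZ]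
        by (simp add: euclidean_representation)
    qed
    have "L2_inner P Z (D z v) - L2_inner P Z (D z0 v)
        = (\<Sum>b\<in>Basis. (v \<bullet> b) * L2_inner P Z (\<lambda>\<omega>. D z b \<omega> - D z0 b \<omega>))"
      using zW \<open>z0 \<in> W\<close> Z DL
      by (simp add: expand L2_inner_diff_right sum_subtractf right_diff_distrib)
    also have "\<bar>\<dots>\<bar> \<le> (\<Sum>b\<in>Basis. norm v * (L2_norm P Z * (C b * norm (z - z0))))"
    proof (rule order_trans[OF sum_abs], rule sum_mono)
      fix b :: 'e assume b: "b \<in> Basis"
      have "\<bar>L2_inner P Z (\<lambda>\<omega>. D z b \<omega> - D z0 b \<omega>)\<bar> \<le> L2_norm P Z * L2_norm P (\<lambda>\<omega>. D z b \<omega> - D z0 b \<omega>)"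
        using zW \<open>z0 \<in> W\<close> Z DL by (intro L2_Cauchy_Schwarz L2_diff)
      also have "\<dots> \<le> L2_norm P Z * (C b * norm (z - z0))"
        using z \<delta>(3)[OF b] zW DL by (intro mult_left_mono Lip) auto
      finally show "\<bar>(v \<bullet> b) * L2_inner P Z (\<lambda>\<omega>. D z b \<omega> - D z0 b \<omega>)\<bar>
          \<le> norm v * (L2_norm P Z * (C b * norm (z - z0)))"
        unfolding abs_mult using Basis_le_norm[OF b, of v] by (intro mult_mono) auto
    qed
    also have "\<dots> = K * norm (z - z0) * norm v * L2_norm P Z"
      by (simp add: K_def sum_distrib_left sum_distrib_right ac_simps)
    finally show "\<bar>L2_inner P Z (D z v) - L2_inner P Z (D z0 v)\<bar> \<le> K * norm (z - z0) * norm v * L2_norm P Z" .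
  qed
  with \<open>0 < K\<close> \<delta>(1) show ?thesis by (rule that)
qed

section \<open>The Hilbert space of the process\<close>

lemma H_space_L2: "X \<in> H_space P f \<Longrightarrow> X \<in> L2 P"
  by (simp add: H_space_def)

lemma H_space_add:
  assumes f: "\<And>x. f x \<in> L2 P" and X: "X \<in> H_space P f" and Y: "Y \<in> H_space P f"
  shows "(\<lambda>\<omega>. X \<omega> + Y \<omega>) \<in> H_space P f"
  unfolding H_space_def
proof (intro CollectI conjI allI impI)
  show "(\<lambda>\<omega>. X \<omega> + Y \<omega>) \<in> L2 P"
    using X Y by (intro L2_add H_space_L2)
  fix \<epsilon> :: real assume "0 < \<epsilon>"
  then have "0 < \<epsilon> / 2" by simp
  then obtain F1 c1 F2 c2 where fin: "finite F1" "finite F2"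
    and 1: "L2_norm P (\<lambda>\<omega>. X \<omega> - (\<Sum>x\<in>F1. c1 x * f x \<omega>)) < \<epsilon> / 2"
    and 2: "L2_norm P (\<lambda>\<omega>. Y \<omega> - (\<Sum>x\<in>F2. c2 x * f x \<omega>)) < \<epsilon> / 2"
    using X Y unfolding H_space_def by blast
  define c where "c x = (if x \<in> F1 then c1 x else 0) + (if x \<in> F2 then c2 x else 0)" for x
  have ext: "(\<Sum>x\<in>F1 \<union> F2. (if x \<in> F then d x else 0) * f x \<omega>) = (\<Sum>x\<in>F. d x * f x \<omega>)"
    if "F = F1 \<or> F = F2" for F d \<omega>
    using fin that by (intro sum.mono_neutral_cong_right) auto
  have "(\<Sum>x\<in>F1 \<union> F2. c x * f x \<omega>) = (\<Sum>x\<in>F1. c1 x * f x \<omega>) + (\<Sum>x\<in>F2. c2 x * f x \<omega>)" for \<omega>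
    using ext[of F1 c1 \<omega>] ext[of F2 c2 \<omega>] unfolding c_def distrib_right sum.distrib by simp
  then have "(\<lambda>\<omega>. X \<omega> + Y \<omega> - (\<Sum>x\<in>F1 \<union> F2. c x * f x \<omega>))
      = (\<lambda>\<omega>. (X \<omega> - (\<Sum>x\<in>F1. c1 x * f x \<omega>)) + (Y \<omega> - (\<Sum>x\<in>F2. c2 x * f x \<omega>)))"
    by (simp add: fun_eq_iff)
  moreover have "L2_norm P (\<lambda>\<omega>. (X \<omega> - (\<Sum>x\<in>F1. c1 x * f x \<omega>)) + (Y \<omega> - (\<Sum>x\<in>F2. c2 x * f x \<omega>)))
      \<le> L2_norm P (\<lambda>\<omega>. X \<omega> - (\<Sum>x\<in>F1. c1 x * f x \<omega>)) + L2_norm P (\<lambda>\<omega>. Y \<omega> - (\<Sum>x\<in>F2. c2 x * f x \<omega>))"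
    using X Y f by (intro L2_norm_triangle L2_intros) (auto dest: H_space_L2)
  ultimately have "L2_norm P (\<lambda>\<omega>. X \<omega> + Y \<omega> - (\<Sum>x\<in>F1 \<union> F2. c x * f x \<omega>)) < \<epsilon>"
    using 1 2 by simp
  then show "\<exists>F c. finite F \<and> L2_norm P (\<lambda>\<omega>. X \<omega> + Y \<omega> - (\<Sum>x\<in>F. c x * f x \<omega>)) < \<epsilon>"
    using fin by blast
qed

lemma H_space_scale:
  assumes X: "X \<in> H_space P f"
  shows "(\<lambda>\<omega>. r * X \<omega>) \<in> H_space P f"
  unfolding H_space_def
proof (intro CollectI conjI allI impI)
  show "(\<lambda>\<omega>. r * X \<omega>) \<in> L2 P"
    using X by (intro L2_scale H_space_L2)
  fix \<epsilon> :: real assume "0 < \<epsilon>"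
  then have "0 < \<epsilon> / (\<bar>r\<bar> + 1)" by (simp add: add_nonneg_pos)
  then obtain F c where F: "finite F" "L2_norm P (\<lambda>\<omega>. X \<omega> - (\<Sum>x\<in>F. c x * f x \<omega>)) < \<epsilon> / (\<bar>r\<bar> + 1)"
    using X unfolding H_space_def by blast
  have "(\<lambda>\<omega>. r * X \<omega> - (\<Sum>x\<in>F. (r * c x) * f x \<omega>)) = (\<lambda>\<omega>. r * (X \<omega> - (\<Sum>x\<in>F. c x * f x \<omega>)))"
    by (simp add: fun_eq_iff right_diff_distrib sum_distrib_left mult.assoc)
  then have "L2_norm P (\<lambda>\<omega>. r * X \<omega> - (\<Sum>x\<in>F. (r * c x) * f x \<omega>))
      = \<bar>r\<bar> * L2_norm P (\<lambda>\<omega>. X \<omega> - (\<Sum>x\<in>F. c x * f x \<omega>))"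
    by (simp add: L2_norm_scale)
  also have "\<dots> \<le> (\<bar>r\<bar> + 1) * L2_norm P (\<lambda>\<omega>. X \<omega> - (\<Sum>x\<in>F. c x * f x \<omega>))"
    by (intro mult_right_mono) auto
  also have "\<dots> < \<epsilon>"
    using F(2) by (simp add: pos_less_divide_eq add_nonneg_pos mult.commute)
  finally show "\<exists>F c. finite F \<and> L2_norm P (\<lambda>\<omega>. r * X \<omega> - (\<Sum>x\<in>F. c x * f x \<omega>)) < \<epsilon>"
    using F(1) by (intro exI[of _ F] exI[of _ "\<lambda>x. r * c x"]) blast
qed

lemma H_space_diff:
  assumes "\<And>x. f x \<in> L2 P" "X \<in> H_space P f" "Y \<in> H_space P f"
  shows "(\<lambda>\<omega>. X \<omega> - Y \<omega>) \<in> H_space P f"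
  using H_space_add[OF assms(1,2) H_space_scale[OF assms(3), of "-1"]] by simp

lemma H_space_zero [simp]: "(\<lambda>\<omega>. 0) \<in> H_space P f"
  unfolding H_space_def by (auto intro!: exI[of _ "{}"] simp: L2_norm_def L2_inner_def)

lemma H_space_sum:
  assumes "\<And>x. f x \<in> L2 P" "\<And>i. i \<in> I \<Longrightarrow> X i \<in> H_space P f"
  shows "(\<lambda>\<omega>. \<Sum>i\<in>I. X i \<omega>) \<in> H_space P f"
  using assms(2) by (induction I rule: infinite_finite_induct) (auto intro: H_space_add[OF assms(1)])

lemma H_space_closed:
  assumes f: "\<And>x. f x \<in> L2 P" and X: "X \<in> L2 P"
    and approx: "\<And>\<epsilon>. 0 < \<epsilon> \<Longrightarrow> \<exists>Y\<in>H_space P f. L2_norm P (\<lambda>\<omega>. X \<omega> - Y \<omega>) < \<epsilon>"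
  shows "X \<in> H_space P f"
  unfolding H_space_def
proof (intro CollectI conjI allI impI X)
  fix \<epsilon> :: real assume "0 < \<epsilon>"
  then have \<epsilon>: "0 < \<epsilon> / 2" by simp
  obtain Y where Y: "Y \<in> H_space P f" "L2_norm P (\<lambda>\<omega>. X \<omega> - Y \<omega>) < \<epsilon> / 2"
    using approx[OF \<epsilon>] by blast
  obtain F c where F: "finite F" "L2_norm P (\<lambda>\<omega>. Y \<omega> - (\<Sum>x\<in>F. c x * f x \<omega>)) < \<epsilon> / 2"
    using Y(1) \<epsilon> unfolding H_space_def by blast
  have "(\<lambda>\<omega>. \<Sum>x\<in>F. c x * f x \<omega>) \<in> L2 P"
    using f by (intro L2_intros)
  then have "L2_norm P (\<lambda>\<omega>. X \<omega> - (\<Sum>x\<in>F. c x * f x \<omega>)) < \<epsilon>"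
    using L2_norm_diff_triangle[OF X H_space_L2[OF Y(1)]] Y(2) F(2) by fastforce
  with F(1) show "\<exists>F c. finite F \<and> L2_norm P (\<lambda>\<omega>. X \<omega> - (\<Sum>x\<in>F. c x * f x \<omega>)) < \<epsilon>"
    by blast
qed

text \<open>Derivatives are limits of difference quotients, and the space is closed.\<close>

lemma H_space_derivative:
  assumes f: "\<And>x. f x \<in> L2 P" and der: "L2_has_derivative P G D u" and G: "\<And>z. G z \<in> H_space P f"
  shows "D h \<in> H_space P f"
proof (rule H_space_closed[OF f])
  have lin: "L2_linear P D" using der by (rule L2_has_derivative_linear)
  have DL: "D v \<in> L2 P" for v using lin by (simp add: L2_linear_def)
  show "D h \<in> L2 P" by (rule DL)
  fix \<epsilon> :: real assume "0 < \<epsilon>"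
  define k where "k = norm h + 1"
  have "0 < k" by (simp add: k_def add_nonneg_pos)
  then obtain d where d: "0 < d" "\<And>z. norm (z - u) < d \<Longrightarrow>
      L2_norm P (\<lambda>\<omega>. G z \<omega> - G u \<omega> - D (z - u) \<omega>) \<le> \<epsilon> / k * norm (z - u)"
    using L2_has_derivative_approx[OF der, of "\<epsilon> / k"] \<open>0 < \<epsilon>\<close> by auto
  define t where "t = d / k"
  have "0 < t" using d(1) \<open>0 < k\<close> by (simp add: t_def)
  define Y where "Y = (\<lambda>\<omega>. (1 / t) * (G (u + t *\<^sub>R h) \<omega> - G u \<omega>))"
  have "Y \<in> H_space P f"
    unfolding Y_def using f G by (intro H_space_scale H_space_diff)
  have GL: "G z \<in> L2 P" for z using G by (rule H_space_L2)
  have "t * norm h < d"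
    using d(1) \<open>0 < k\<close> by (simp add: t_def k_def field_simps)
  then have near: "L2_norm P (\<lambda>\<omega>. G (u + t *\<^sub>R h) \<omega> - G u \<omega> - D (t *\<^sub>R h) \<omega>) \<le> \<epsilon> / k * (t * norm h)"
    using d(2)[of "u + t *\<^sub>R h"] \<open>0 < t\<close> by simp
  have "(\<lambda>\<omega>. Y \<omega> - D h \<omega>) = (\<lambda>\<omega>. (1 / t) * (G (u + t *\<^sub>R h) \<omega> - G u \<omega> - t * D h \<omega>))"
    using \<open>0 < t\<close> by (simp add: Y_def fun_eq_iff field_simps)
  then have "L2_norm P (\<lambda>\<omega>. D h \<omega> - Y \<omega>)
      = (1 / t) * L2_norm P (\<lambda>\<omega>. G (u + t *\<^sub>R h) \<omega> - G u \<omega> - t * D h \<omega>)"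
    using \<open>0 < t\<close> by (subst L2_norm_minus_commute) (simp only: L2_norm_scale, simp)
  also have "L2_norm P (\<lambda>\<omega>. G (u + t *\<^sub>R h) \<omega> - G u \<omega> - t * D h \<omega>)
      = L2_norm P (\<lambda>\<omega>. G (u + t *\<^sub>R h) \<omega> - G u \<omega> - D (t *\<^sub>R h) \<omega>)"
  proof (rule L2_norm_AE_cong)
    have "AE \<omega> in P. D (t *\<^sub>R h) \<omega> = t * D h \<omega>"
      using lin by (simp add: L2_linear_def)
    then show "AE \<omega> in P. G (u + t *\<^sub>R h) \<omega> - G u \<omega> - t * D h \<omega> = G (u + t *\<^sub>R h) \<omega> - G u \<omega> - D (t *\<^sub>R h) \<omega>"
      by eventually_elim simp
  qed (intro L2_diff L2_scale GL DL)+
  also have "(1 / t) * \<dots> \<le> (1 / t) * (\<epsilon> / k * (t * norm h))"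
    using near \<open>0 < t\<close> by (intro mult_left_mono) auto
  also have "\<dots> = \<epsilon> * (norm h / k)" using \<open>0 < t\<close> by simp
  also have "\<dots> < \<epsilon> * 1"
    using \<open>0 < \<epsilon>\<close> \<open>0 < k\<close> by (intro mult_strict_left_mono) (auto simp: k_def)
  finally show "\<exists>Y\<in>H_space P f. L2_norm P (\<lambda>\<omega>. D h \<omega> - Y \<omega>) < \<epsilon>"
    using \<open>Y \<in> H_space P f\<close> by auto
qed

lemma H_space_mean_zero:
  assumes "prob_space P" and f: "\<And>x. f x \<in> L2 P" and mean: "\<And>x. (\<integral>\<omega>. f x \<omega> \<partial>P) = 0"
    and X: "X \<in> H_space P f"
  shows "(\<integral>\<omega>. X \<omega> \<partial>P) = 0"
proof -
  interpret prob_space P by fact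
  let ?one = "\<lambda>\<omega>. 1 :: real"
  have one: "?one \<in> L2 P" by (simp add: L2_def)
  have norm_one: "L2_norm P ?one = 1" by (simp add: L2_norm_def L2_inner_def prob_space)
  have inner_one: "L2_inner P ?one Y = (\<integral>\<omega>. Y \<omega> \<partial>P)" for Y by (simp add: L2_inner_def)
  have "\<bar>\<integral>\<omega>. X \<omega> \<partial>P\<bar> \<le> 0 + \<epsilon>" if \<epsilon>: "0 < \<epsilon>" for \<epsilon>
  proof -
    obtain F c where F: "finite F" "L2_norm P (\<lambda>\<omega>. X \<omega> - (\<Sum>x\<in>F. c x * f x \<omega>)) < \<epsilon>"
      using X \<epsilon> unfolding H_space_def by blast
    have S: "(\<lambda>\<omega>. \<Sum>x\<in>F. c x * f x \<omega>) \<in> L2 P" using f by (intro L2_intros)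
    have "L2_inner P ?one (\<lambda>\<omega>. \<Sum>x\<in>F. c x * f x \<omega>) = (\<Sum>x\<in>F. L2_inner P ?one (\<lambda>\<omega>. c x * f x \<omega>))"
      using one f by (intro L2_inner_sum_right L2_scale)
    also have "\<dots> = 0"
      by (simp only: L2_inner_scale_right inner_one mean) simp
    finally have "L2_inner P ?one X = L2_inner P ?one (\<lambda>\<omega>. X \<omega> - (\<Sum>x\<in>F. c x * f x \<omega>))"
      using L2_inner_diff_right[OF one H_space_L2[OF X] S] by simp
    then have "\<bar>L2_inner P ?one X\<bar> \<le> L2_norm P (\<lambda>\<omega>. X \<omega> - (\<Sum>x\<in>F. c x * f x \<omega>))"
      using L2_Cauchy_Schwarz[OF one L2_diff[OF H_space_L2[OF X] S]] norm_one by simp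
    then show ?thesis using F(2) inner_one by simp
  qed
  then show ?thesis using field_le_epsilon[of "\<bar>\<integral>\<omega>. X \<omega> \<partial>P\<bar>" 0] by simp
qed

section \<open>The support cone at an interior point\<close>

lemma is_chart_inverse:
  assumes "is_chart (U, \<phi>)"
  shows "\<And>p. p \<in> U \<Longrightarrow> chart_inv (U, \<phi>) (\<phi> p) = p"
    and "\<And>u. u \<in> \<phi> ` U \<Longrightarrow> chart_inv (U, \<phi>) u \<in> U"
    and "\<And>u. u \<in> \<phi> ` U \<Longrightarrow> \<phi> (chart_inv (U, \<phi>) u) = u"
  using assms by (auto simp: is_chart_def homeomorphism_def)

lemma is_chart_open_image:
  assumes "is_chart (U, \<phi>)" "open V"
  shows "open (\<phi> ` (V \<inter> U))"
proof -
  have "openin (top_of_set (\<phi> ` U)) (\<phi> ` (V \<inter> U))"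
    using assms by (intro homeomorphism_imp_open_map[of U "\<phi> ` U" \<phi> "chart_inv (U, \<phi>)"])
      (auto simp: is_chart_def openin_open)
  moreover have "open (\<phi> ` U)" using assms by (simp add: is_chart_def)
  ultimately show ?thesis by (rule openin_open_trans)
qed

lemma Ck_on_SucD:
  assumes "Ck_on (Suc n) f S" "x \<in> S"
  shows "(f has_derivative frechet_derivative f (at x)) (at x)"
  using assms by (simp add: frechet_derivative_works)

lemma Ck_on_1_along_line:
  fixes w :: "'e::real_normed_vector"
  assumes G: "Ck_on 2 G S" and T: "\<And>t. t \<in> T \<Longrightarrow> u + t *\<^sub>R w \<in> S"
  shows "Ck_on 1 (\<lambda>t. G (u + t *\<^sub>R w)) T"
proof -
  have der: "((\<lambda>t. G (u + t *\<^sub>R w)) has_derivative (\<lambda>s. frechet_derivative G (at (u + t *\<^sub>R w)) (s *\<^sub>R w))) (at t)"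
    if "t \<in> T" for t
  proof -
    have "((\<lambda>t. u + t *\<^sub>R w) has_derivative (\<lambda>s. s *\<^sub>R w)) (at t)"
      by (auto intro!: derivative_eq_intros)
    moreover have "(G has_derivative frechet_derivative G (at (u + t *\<^sub>R w))) (at (u + t *\<^sub>R w))"
      using G T[OF that] by (intro Ck_on_SucD[of 1 G S]) (simp_all add: numeral_2_eq_2)
    ultimately show ?thesis by (rule has_derivative_compose)
  qed
  have "continuous_on T (\<lambda>t. frechet_derivative (\<lambda>t. G (u + t *\<^sub>R w)) (at t) s)" for s
  proof -
    have "Ck_on 1 (\<lambda>y. frechet_derivative G (at y) (s *\<^sub>R w)) S"
      using G by (simp add: numeral_2_eq_2)
    then have "continuous_on S (\<lambda>y. frechet_derivative G (at y) (s *\<^sub>R w))"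
      by (auto intro!: continuous_at_imp_continuous_on differentiable_imp_continuous_within)
    moreover have "continuous_on T (\<lambda>t. u + t *\<^sub>R w)" by (intro continuous_intros)
    moreover have "(\<lambda>t. u + t *\<^sub>R w) ` T \<subseteq> S" using T by blast
    ultimately have "continuous_on T (\<lambda>t. frechet_derivative G (at (u + t *\<^sub>R w)) (s *\<^sub>R w))"
      by (rule continuous_on_compose2)
    moreover have "frechet_derivative (\<lambda>t. G (u + t *\<^sub>R w)) (at t) s
        = frechet_derivative G (at (u + t *\<^sub>R w)) (s *\<^sub>R w)" if "t \<in> T" for t
      using frechet_derivative_at[OF der[OF that]] by metis
    ultimately show ?thesis by (simp cong: continuous_on_cong)
  qed
  then show ?thesis using der by (auto simp: differentiable_def)
qed

text \<open>A chart \<open>\<phi>\<close> that straightens \<open>M\<close> around \<open>x\<close> is compared with the chart \<open>chart_at A x\<close> in which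
  tangent vectors at \<open>x\<close> are expressed; \<open>transition\<close> is the coordinate change.\<close>

locale straightening_chart =
  fixes A :: "('m::t2_space, 'e::euclidean_space) chart set"
    and M V U :: "'m set" and x :: 'm and \<phi> :: "'m \<Rightarrow> 'e" and L :: "'e set"
  assumes atlas: "Ck_atlas 3 A"
    and diffeo: "Ck_diffeo A 2 U \<phi>"
    and V: "open V" "x \<in> V" and x: "x \<in> M" "x \<in> U"
    and L: "subspace L" and straight: "\<phi> ` (U \<inter> (M \<inter> V)) = \<phi> ` U \<inter> L"
begin

definition chart_dom :: "'m set" where "chart_dom = fst (chart_at A x)"

definition coord :: "'m \<Rightarrow> 'e" where "coord = snd (chart_at A x)"

definition param :: "'e \<Rightarrow> 'm" where "param = chart_inv (chart_at A x)"

definition unstraighten :: "'e \<Rightarrow> 'm" where "unstraighten = chart_inv (U, \<phi>)"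

definition transition :: "'e \<Rightarrow> 'e" where "transition = coord \<circ> unstraighten"

definition overlap :: "'e set" where "overlap = \<phi> ` (chart_dom \<inter> U)"

definition dtransition :: "'e \<Rightarrow> 'e \<Rightarrow> 'e" where
  "dtransition u = frechet_derivative transition (at u)"

lemma chart_at_in: "chart_at A x \<in> A" "x \<in> chart_dom"
proof -
  have "x \<in> (\<Union>c\<in>A. fst c)" using atlas by (simp only: Ck_atlas_def UNIV_I)
  then have "\<exists>c. c \<in> A \<and> x \<in> fst c" by blast
  from someI_ex[OF this] show "chart_at A x \<in> A" "x \<in> chart_dom"
    by (simp_all add: chart_at_def chart_dom_def)
qed

lemma charts: "is_chart (U, \<phi>)" "is_chart (chart_dom, coord)"
  using diffeo atlas chart_at_in(1)
  by (auto simp: Ck_diffeo_def Ck_atlas_def chart_dom_def coord_def)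

lemma param_eq: "param = chart_inv (chart_dom, coord)"
  by (simp add: param_def chart_dom_def coord_def)

lemmas straight_inverse = is_chart_inverse[OF charts(1), folded unstraighten_def]

lemmas coord_inverse = is_chart_inverse[OF charts(2), folded param_eq]

lemma open_chart_dom: "open chart_dom" and open_U: "open U"
  using charts by (simp_all add: is_chart_def)

lemma open_overlap: "open overlap"
  unfolding overlap_def using charts(1) open_chart_dom by (rule is_chart_open_image)

lemma base_in_overlap: "\<phi> x \<in> overlap"
  using x chart_at_in by (simp add: overlap_def)

lemma base_in_L: "\<phi> x \<in> L"
  using straight x V by blast

lemma overlap_subset: "overlap \<subseteq> \<phi> ` U"
  by (auto simp: overlap_def)

lemma param_transition:
  assumes "u \<in> overlap"
  shows "param (transition u) = unstraighten u"
  using assms straight_inverse coord_inverse by (auto simp: overlap_def transition_def)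

lemma transition_base: "transition (\<phi> x) = coord x"
  using x straight_inverse by (simp add: transition_def)

lemma transition_in_image: "u \<in> overlap \<Longrightarrow> transition u \<in> coord ` chart_dom"
  using straight_inverse by (auto simp: overlap_def transition_def)

lemma unstraighten_in_M:
  assumes "u \<in> \<phi> ` U" "u \<in> L"
  shows "unstraighten u \<in> M"
proof -
  have "u \<in> \<phi> ` (U \<inter> (M \<inter> V))" using assms straight by blast
  then show ?thesis using straight_inverse by auto
qed

lemma compatible: "d \<in> A \<Longrightarrow> Ck_compatible 2 d (U, \<phi>)"
  using diffeo by (simp add: Ck_diffeo_def)

lemma Ck_transition: "Ck_on 2 transition overlap"
  using compatible[OF chart_at_in(1)]
  by (simp add: Ck_compatible_def transition_def overlap_def coord_def chart_dom_def unstraighten_def)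

lemma transition_derivative:
  assumes "u \<in> overlap"
  shows "(transition has_derivative dtransition u) (at u)"
  using Ck_on_SucD[of 1 transition overlap u] Ck_transition assms
  by (simp add: dtransition_def numeral_2_eq_2)

lemma linear_dtransition: "linear (dtransition (\<phi> x))"
  using transition_derivative[OF base_in_overlap] by (rule has_derivative_linear)

lemma dtransition_right_inverse:
  obtains \<sigma>' where "(\<phi> \<circ> param has_derivative \<sigma>') (at (coord x))"
    "\<And>v. dtransition (\<phi> x) (\<sigma>' v) = v"
proof -
  let ?S = "coord ` (chart_dom \<inter> U)"
  have "Ck_on 2 (\<phi> \<circ> param) ?S"
    using compatible[OF chart_at_in(1)]
    by (simp add: Ck_compatible_def coord_def chart_dom_def param_def)
  moreover have S: "coord x \<in> ?S" using x chart_at_in by simp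
  ultimately obtain \<sigma>' where \<sigma>': "(\<phi> \<circ> param has_derivative \<sigma>') (at (coord x))"
    using Ck_on_SucD[of 1 "\<phi> \<circ> param" ?S "coord x"] by (auto simp: numeral_2_eq_2)
  have "open ?S"
    using is_chart_open_image[OF charts(2) open_U] by (simp add: Int_commute)
  have "(\<phi> \<circ> param) (coord x) = \<phi> x" using coord_inverse chart_at_in by simp
  then have "(transition \<circ> (\<phi> \<circ> param) has_derivative dtransition (\<phi> x) \<circ> \<sigma>') (at (coord x))"
    using transition_derivative[OF base_in_overlap] by (intro diff_chain_at \<sigma>') simp
  then have "((\<lambda>z. z) has_derivative dtransition (\<phi> x) \<circ> \<sigma>') (at (coord x))"
  proof (rule has_derivative_transform_within_open[OF _ \<open>open ?S\<close> S])
    fix z assume "z \<in> ?S"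
    then show "(transition \<circ> (\<phi> \<circ> param)) z = z"
      using coord_inverse straight_inverse by (auto simp: transition_def)
  qed
  then have "dtransition (\<phi> x) \<circ> \<sigma>' = (\<lambda>v. v)"
    using has_derivative_unique has_derivative_ident by blast
  then show ?thesis using \<sigma>' by (intro that) (auto simp: fun_eq_iff)
qed

text \<open>The straight segment in direction \<open>w\<close> is a curve in \<open>M\<close>.\<close>

lemma dtransition_in_support_cone:
  assumes w: "w \<in> L"
  shows "dtransition (\<phi> x) w \<in> support_cone A M x"
proof -
  define \<gamma> where "\<gamma> t = unstraighten (\<phi> x + t *\<^sub>R w)" for t
  have "open ((\<lambda>t::real. \<phi> x + t *\<^sub>R w) -` overlap)"
    using open_overlap by (rule open_vimage) (intro continuous_intros)
  moreover have "0 \<in> (\<lambda>t::real. \<phi> x + t *\<^sub>R w) -` overlap"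
    using base_in_overlap by simp
  ultimately obtain \<delta> where \<delta>: "0 < \<delta>" "ball 0 \<delta> \<subseteq> (\<lambda>t::real. \<phi> x + t *\<^sub>R w) -` overlap"
    by (meson open_contains_ball)
  have ov: "\<phi> x + t *\<^sub>R w \<in> overlap" if "t \<in> {-\<delta><..<\<delta>}" for t
    using \<delta>(2) that by (auto simp: subset_eq)
  have \<gamma>0: "\<gamma> 0 = x" using x straight_inverse by (simp add: \<gamma>_def)
  have "C1_curve A \<delta> \<gamma>"
    unfolding C1_curve_def
  proof (intro conjI ballI)
    have "continuous_on (\<phi> ` U) unstraighten"
      using charts(1) by (simp add: is_chart_def homeomorphism_def unstraighten_def)
    moreover have "continuous_on {-\<delta><..<\<delta>} (\<lambda>t. \<phi> x + t *\<^sub>R w)"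
      by (intro continuous_intros)
    moreover have "(\<lambda>t. \<phi> x + t *\<^sub>R w) ` {-\<delta><..<\<delta>} \<subseteq> \<phi> ` U"
      using ov overlap_subset by blast
    ultimately show "continuous_on {-\<delta><..<\<delta>} \<gamma>"
      unfolding \<gamma>_def by (rule continuous_on_compose2)
    fix d assume "d \<in> A"
    have "Ck_on 1 (\<lambda>t. (snd d \<circ> unstraighten) (\<phi> x + t *\<^sub>R w)) ({-\<delta><..<\<delta>} \<inter> \<gamma> -` fst d)"
    proof (rule Ck_on_1_along_line)
      show "Ck_on 2 (snd d \<circ> unstraighten) (\<phi> ` (fst d \<inter> U))"
        using compatible[OF \<open>d \<in> A\<close>] by (simp add: Ck_compatible_def unstraighten_def)
      fix t assume t: "t \<in> {-\<delta><..<\<delta>} \<inter> \<gamma> -` fst d"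
      then have "\<phi> x + t *\<^sub>R w \<in> \<phi> ` U" using ov overlap_subset by blast
      then have "\<gamma> t \<in> U" "\<phi> x + t *\<^sub>R w = \<phi> (\<gamma> t)"
        using straight_inverse by (simp_all add: \<gamma>_def)
      then show "\<phi> x + t *\<^sub>R w \<in> \<phi> ` (fst d \<inter> U)" using t by auto
    qed
    then show "Ck_on 1 (snd d \<circ> \<gamma>) ({-\<delta><..<\<delta>} \<inter> \<gamma> -` fst d)"
      by (simp add: \<gamma>_def comp_def)
  qed
  moreover have "\<gamma> t \<in> M" if "t \<in> {0..<\<delta>}" for t
    unfolding \<gamma>_def
  proof (rule unstraighten_in_M)
    show "\<phi> x + t *\<^sub>R w \<in> \<phi> ` U" using ov[of t] that overlap_subset by auto
    show "\<phi> x + t *\<^sub>R w \<in> L" using L base_in_L w by (simp add: subspace_add subspace_scale)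
  qed
  moreover have "velocity A \<gamma> = dtransition (\<phi> x) w"
  proof -
    have "((\<lambda>t::real. \<phi> x + t *\<^sub>R w) has_vector_derivative w) (at 0)"
      by (auto intro!: derivative_eq_intros)
    then have "(transition \<circ> (\<lambda>t::real. \<phi> x + t *\<^sub>R w) has_vector_derivative dtransition (\<phi> x) w) (at 0)"
      using transition_derivative[OF base_in_overlap]
      by (intro vector_derivative_diff_chain_within) (auto intro: has_derivative_at_withinI)
    moreover have "snd (chart_at A (\<gamma> 0)) \<circ> \<gamma> = transition \<circ> (\<lambda>t. \<phi> x + t *\<^sub>R w)"
      unfolding \<gamma>0 by (simp add: \<gamma>_def fun_eq_iff transition_def coord_def)
    ultimately show ?thesis by (simp add: velocity_def vector_derivative_at)
  qed
  ultimately show ?thesis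
    using \<delta>(1) \<gamma>0 unfolding support_cone_def by (intro CollectI exI[of _ \<gamma>] conjI exI[of _ \<delta>]) auto
qed

text \<open>In the straightening chart the difference quotients of a curve in \<open>M\<close> lie in the closed
  subspace \<open>L\<close>, and so does their limit.\<close>

lemma support_cone_subset: "support_cone A M x \<subseteq> dtransition (\<phi> x) ` L"
proof
  fix v assume "v \<in> support_cone A M x"
  then obtain \<gamma> \<delta> where "0 < \<delta>" and C1: "C1_curve A \<delta> \<gamma>" and \<gamma>0: "\<gamma> 0 = x"
    and in_M: "\<And>t. t \<in> {0..<\<delta>} \<Longrightarrow> \<gamma> t \<in> M" and v: "v = velocity A \<gamma>"
    by (auto simp: support_cone_def)
  obtain \<sigma>' where \<sigma>': "(\<phi> \<circ> param has_derivative \<sigma>') (at (coord x))"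
    and inv: "\<And>v. dtransition (\<phi> x) (\<sigma>' v) = v"
    using dtransition_right_inverse by blast
  have "Ck_on 1 (coord \<circ> \<gamma>) ({-\<delta><..<\<delta>} \<inter> \<gamma> -` chart_dom)"
    using C1 chart_at_in(1) by (simp add: C1_curve_def coord_def chart_dom_def)
  then have "coord \<circ> \<gamma> differentiable (at 0)"
    using \<open>0 < \<delta>\<close> \<gamma>0 chart_at_in by simp
  then have dcoord: "(coord \<circ> \<gamma> has_vector_derivative v) (at 0)"
    unfolding v velocity_def \<gamma>0 coord_def[symmetric] by (simp add: vector_derivative_works)
  have "(\<phi> \<circ> param has_derivative \<sigma>') (at ((coord \<circ> \<gamma>) 0))"
    using \<sigma>' \<gamma>0 by simp
  then have "((\<phi> \<circ> param) \<circ> (coord \<circ> \<gamma>) has_vector_derivative \<sigma>' v) (at 0)"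
    by (rule vector_derivative_diff_chain_within[OF dcoord has_derivative_at_withinI])
  moreover define \<beta> where "\<beta> = (\<phi> \<circ> param) \<circ> (coord \<circ> \<gamma>)"
  moreover have "\<beta> 0 = \<phi> x" using \<gamma>0 coord_inverse chart_at_in by (simp add: \<beta>_def)
  ultimately have "((\<lambda>t. (1 / \<bar>t\<bar>) *\<^sub>R (\<beta> t - (\<phi> x + t *\<^sub>R \<sigma>' v))) \<longlongrightarrow> 0) (at 0)"
    by (simp add: has_vector_derivative_def has_derivative_within)
  then have "((\<lambda>t. (1 / \<bar>t\<bar>) *\<^sub>R (\<beta> t - (\<phi> x + t *\<^sub>R \<sigma>' v)) + \<sigma>' v) \<longlongrightarrow> 0 + \<sigma>' v) (at_right 0)"
    by (intro tendsto_add tendsto_const) (auto intro: tendsto_mono[OF at_le])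
  then have "((\<lambda>t. (1 / t) *\<^sub>R (\<beta> t - \<phi> x)) \<longlongrightarrow> 0 + \<sigma>' v) (at_right 0)"
  proof (rule Lim_transform_eventually)
    show "\<forall>\<^sub>F t in at_right 0. (1 / \<bar>t\<bar>) *\<^sub>R (\<beta> t - (\<phi> x + t *\<^sub>R \<sigma>' v)) + \<sigma>' v = (1 / t) *\<^sub>R (\<beta> t - \<phi> x)"
      using eventually_at_right_less[of 0]
      by eventually_elim (simp add: algebra_simps)
  qed
  moreover have "eventually (\<lambda>t. (1 / t) *\<^sub>R (\<beta> t - \<phi> x) \<in> L) (at_right 0)"
  proof -
    have "continuous (at 0) \<gamma>"
      using C1 \<open>0 < \<delta>\<close> by (intro continuous_on_interior[of "{-\<delta><..<\<delta>}"]) (auto simp: C1_curve_def)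
    then have "(\<gamma> \<longlongrightarrow> x) (at_right 0)"
      using \<gamma>0 by (auto simp: continuous_at intro: tendsto_mono[OF at_le])
    moreover have "open (chart_dom \<inter> U \<inter> V)" "x \<in> chart_dom \<inter> U \<inter> V"
      using V x chart_at_in open_U open_chart_dom by auto
    ultimately have "eventually (\<lambda>t. \<gamma> t \<in> chart_dom \<inter> U \<inter> V) (at_right 0)"
      by (rule topological_tendstoD)
    moreover have "eventually (\<lambda>t. t \<in> {0<..<\<delta>}) (at_right 0)"
      using \<open>0 < \<delta>\<close> by (rule eventually_at_right_real)
    ultimately show ?thesis
    proof eventually_elim
      case (elim t)
      then have "\<gamma> t \<in> U \<inter> (M \<inter> V)" using in_M[of t] by auto
      then have "\<phi> (\<gamma> t) \<in> L" using straight by blast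
      then show ?case
        using elim coord_inverse L base_in_L by (simp add: \<beta>_def subspace_diff subspace_scale)
    qed
  qed
  ultimately have "\<sigma>' v \<in> L"
    using closed_subspace[OF L] by (intro Lim_in_closed_set[of L _ "at_right 0"]) auto
  then show "v \<in> dtransition (\<phi> x) ` L" using inv[of v] by force
qed

lemma support_cone_eq: "support_cone A M x = dtransition (\<phi> x) ` L"
  using support_cone_subset dtransition_in_support_cone by blast

lemma subspace_support_cone: "subspace (support_cone A M x)"
  unfolding support_cone_eq using linear_dtransition L by (rule linear_subspace_image)

text \<open>The coordinate change is of class \<open>C\<^sup>2\<close>, so its partial derivatives are differentiable at \<open>x\<close>.\<close>

lemma dtransition_Lipschitz:
  obtains C d where "0 < C" "0 < d"
    "\<And>u w. norm (u - \<phi> x) < d \<Longrightarrow> u \<in> overlap \<Longrightarrow>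
      norm (dtransition u w - dtransition (\<phi> x) w) \<le> C * norm (u - \<phi> x) * norm w"
proof -
  have "\<exists>C d. 0 < C \<and> 0 < d \<and> (\<forall>u. norm (u - \<phi> x) < d \<longrightarrow>
      norm (dtransition u b - dtransition (\<phi> x) b) \<le> C * norm (u - \<phi> x))" for b
  proof -
    have "Ck_on 1 (\<lambda>u. dtransition u b) overlap"
      using Ck_transition by (simp add: numeral_2_eq_2 dtransition_def)
    then have "((\<lambda>u. dtransition u b) has_derivative frechet_derivative (\<lambda>u. dtransition u b) (at (\<phi> x))) (at (\<phi> x))"
      using base_in_overlap by (intro Ck_on_SucD[of 0]) auto
    then show ?thesis by (rule has_derivative_Lipschitz) blast
  qed
  then obtain C d where C: "\<And>b. 0 < C b" and d: "\<And>b. 0 < d b"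
    and Lip: "\<And>b u. norm (u - \<phi> x) < d b \<Longrightarrow>
      norm (dtransition u b - dtransition (\<phi> x) b) \<le> C b * norm (u - \<phi> x)"
    by metis
  define \<delta> where "\<delta> = Min (d ` Basis)"
  have "0 < \<delta>" using d by (simp add: \<delta>_def)
  have \<delta>_le: "\<delta> \<le> d b" if "b \<in> Basis" for b
    unfolding \<delta>_def using that by (intro Min_le) auto
  define K where "K = sum C Basis"
  have "0 < K" unfolding K_def using C by (intro sum_pos) auto
  moreover note \<open>0 < \<delta>\<close>
  moreover have "norm (dtransition u w - dtransition (\<phi> x) w) \<le> K * norm (u - \<phi> x) * norm w"
    if u: "norm (u - \<phi> x) < \<delta>" "u \<in> overlap" for u w
  proof -
    have expand: "dtransition y w = (\<Sum>b\<in>Basis. (w \<bullet> b) *\<^sub>R dtransition y b)" if "y \<in> overlap" for y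
    proof -
      have lin: "linear (dtransition y)"
        using transition_derivative[OF that] by (rule has_derivative_linear)
      show ?thesis
        using linear_sum[OF lin, of "\<lambda>b. (w \<bullet> b) *\<^sub>R b" Basis] linear_scale[OF lin]
        by (simp add: euclidean_representation)
    qed
    have "dtransition u w - dtransition (\<phi> x) w
        = (\<Sum>b\<in>Basis. (w \<bullet> b) *\<^sub>R (dtransition u b - dtransition (\<phi> x) b))"
      using expand[OF u(2)] expand[OF base_in_overlap] by (simp add: sum_subtractf scaleR_diff_right)
    also have "norm \<dots> \<le> (\<Sum>b\<in>Basis. norm w * (C b * norm (u - \<phi> x)))"
    proof (rule sum_norm_le)
      fix b :: 'e assume b: "b \<in> Basis"
      have "norm (dtransition u b - dtransition (\<phi> x) b) \<le> C b * norm (u - \<phi> x)"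
        using u(1) \<delta>_le[OF b] by (intro Lip) simp
      then show "norm ((w \<bullet> b) *\<^sub>R (dtransition u b - dtransition (\<phi> x) b)) \<le> norm w * (C b * norm (u - \<phi> x))"
        unfolding norm_scaleR using Basis_le_norm[OF b, of w] by (intro mult_mono) auto
    qed
    also have "\<dots> = K * norm (u - \<phi> x) * norm w"
      by (simp add: K_def sum_distrib_left sum_distrib_right ac_simps)
    finally show ?thesis .
  qed
  ultimately show ?thesis by (rule that)
qed

end

section \<open>Second order contact in normal directions\<close>

context straightening_chart
begin

text \<open>A unit vector \<open>v\<close> normal to the image of \<open>M\<close> at \<open>f x\<close> sees nearby points \<open>f y\<close> only to second
  order. In the straightening chart join \<open>x\<close> to \<open>y\<close> by a straight segment in direction \<open>w\<close>. The
  derivative of \<open>\<langle>v, f\<rangle>\<close> along it vanishes at \<open>x\<close>, and along the segment it stays below a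
  multiple of \<open>(norm w)\<^sup>2\<close>, since the differentials of \<open>f\<close> and of the coordinate change are
  Lipschitz at \<open>x\<close>. Finally \<open>norm w\<close> is at most a multiple of \<open>\<parallel>f y - f x\<parallel>\<close> because \<open>f\<close> is an immersion.\<close>

lemma second_order_contact:
  fixes f :: "'m \<Rightarrow> 'w \<Rightarrow> real"
  assumes fL2: "\<And>y. f y \<in> L2 P"
    and smooth: "L2_Ck_on 2 P (f \<circ> param) (coord ` chart_dom)"
    and D: "L2_has_derivative P (f \<circ> param) D (coord x)"
    and immersion: "\<And>X. L2_norm P (D X) = 0 \<Longrightarrow> X = 0"
  obtains K G where "0 < K" "open G" "x \<in> G"
    "\<And>y v. y \<in> G \<Longrightarrow> y \<in> M \<Longrightarrow> v \<in> L2 P \<Longrightarrow> L2_norm P v = 1 \<Longrightarrow> L2_inner P v (f x) = 0 \<Longrightarrow>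
      (\<And>X. X \<in> support_cone A M x \<Longrightarrow> L2_inner P v (D X) = 0) \<Longrightarrow>
      L2_inner P v (f y) \<le> K * (L2_norm P (\<lambda>\<omega>. f y \<omega> - f x \<omega>))\<^sup>2"
proof -
  define u0 z0 where "u0 = \<phi> x" and "z0 = coord x"
  let ?Z = "coord ` chart_dom"
  have gL2: "(f \<circ> param) z \<in> L2 P" for z using fL2 by simp
  have param0: "param z0 = x" using coord_inverse chart_at_in by (simp add: z0_def)
  have "open ?Z" using charts(2) by (simp add: is_chart_def)
  have z0: "z0 \<in> ?Z" using chart_at_in by (simp add: z0_def)
  obtain E where E: "\<And>z. z \<in> ?Z \<Longrightarrow> L2_has_derivative P (f \<circ> param) (E z) z"
    and E1: "\<And>b. L2_Ck_on 1 P (\<lambda>z. E z b) ?Z"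
    using smooth by (auto simp: numeral_2_eq_2)
  have E_lin: "L2_linear P (E z)" if "z \<in> ?Z" for z
    using E[OF that] by (rule L2_has_derivative_linear)
  have E_der: "\<exists>E'. L2_has_derivative P (\<lambda>z. E z b) E' z0" for b
    using E1[of b] z0 by auto
  obtain C1 d1 where C1: "0 < C1" "0 < d1" and
    E_Lip: "\<And>z q Y. norm (z - z0) < d1 \<Longrightarrow> Y \<in> L2 P \<Longrightarrow>
      z \<in> ?Z \<and> \<bar>L2_inner P Y (E z q) - L2_inner P Y (E z0 q)\<bar> \<le> C1 * norm (z - z0) * norm q * L2_norm P Y"
    using L2_derivative_Lipschitz[OF \<open>open ?Z\<close> z0 E_lin E_der] by blast
  have E_eq_D: "L2_inner P Y (E z0 q) = L2_inner P Y (D q)" if "Y \<in> L2 P" for Y q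
    using has_derivative_unique[OF L2_has_derivative_inner[OF E[OF z0] gL2 that]
        L2_has_derivative_inner[OF D[folded z0_def] gL2 that]]
    by (rule fun_cong)
  have D_lin: "L2_linear P D" using D by (rule L2_has_derivative_linear)
  have DL2: "D X \<in> L2 P" for X using D_lin by (simp add: L2_linear_def)
  obtain C2 where C2: "0 < C2" "\<And>q. L2_norm P (D q) \<le> C2 * norm q"
    using L2_linear_bounded[OF D_lin] by blast
  obtain C3 d3 where C3: "0 < C3" "0 < d3" and
    dt_Lip: "\<And>u w. norm (u - u0) < d3 \<Longrightarrow> u \<in> overlap \<Longrightarrow>
      norm (dtransition u w - dtransition u0 w) \<le> C3 * norm (u - u0) * norm w"
    unfolding u0_def using dtransition_Lipschitz by blast
  have t_der: "(transition has_derivative dtransition u0) (at u0)"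
    unfolding u0_def using base_in_overlap by (rule transition_derivative)
  obtain C4 d4 where C4: "0 < C4" "0 < d4" and
    t_Lip: "\<And>u. norm (u - u0) < d4 \<Longrightarrow> norm (transition u - z0) \<le> C4 * norm (u - u0)"
    using has_derivative_Lipschitz[OF t_der] transition_base unfolding u0_def z0_def by metis
  obtain C5 where C5: "0 < C5" "\<And>w. norm (dtransition u0 w) \<le> norm w * C5"
    using bounded_linear.pos_bounded[OF has_derivative_bounded_linear[OF t_der]] by blast
  obtain \<sigma>' where "(\<phi> \<circ> param has_derivative \<sigma>') (at z0)"
    unfolding z0_def using dtransition_right_inverse by blast
  then obtain C6 d6 where C6: "0 < C6" "0 < d6" and
    s_Lip: "\<And>z. norm (z - z0) < d6 \<Longrightarrow> norm (\<phi> (param z) - u0) \<le> C6 * norm (z - z0)"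
    using has_derivative_Lipschitz param0 unfolding u0_def comp_def by metis
  obtain c d7 where c: "0 < c" "0 < d7" and
    expanding: "\<And>z. norm (z - z0) < d7 \<Longrightarrow> c * norm (z - z0) \<le> L2_norm P (\<lambda>\<omega>. f (param z) \<omega> - f x \<omega>)"
  proof (rule L2_has_derivative_expanding[OF D[folded z0_def] immersion gL2])
    fix c d :: real
    assume "0 < c" "0 < d" and "\<And>z. norm (z - z0) < d \<Longrightarrow> (f \<circ> param) z \<in> L2 P \<Longrightarrow>
      c * norm (z - z0) \<le> L2_norm P (\<lambda>\<omega>. (f \<circ> param) z \<omega> - (f \<circ> param) z0 \<omega>)"
    then show thesis using that[of c d] gL2 param0 by simp
  qed
  obtain d8 where d8: "0 < d8" "ball u0 d8 \<subseteq> overlap"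
    using open_overlap base_in_overlap unfolding u0_def by (meson open_contains_ball)
  \<comment> \<open>The coordinate change maps the ball of radius \<open>d / C4\<close> into the ball of radius \<open>d\<close>; radius at
    most \<open>1\<close> bounds \<open>(norm w)\<^sup>2\<close> by \<open>norm w\<close>.\<close>
  define \<epsilon> where "\<epsilon> = Min {1, d3, d4, d8, d1 / C4, d6 / C4, d7 / C4}"
  have "0 < \<epsilon>" unfolding \<epsilon>_def using C1 C3 C4 C6 c d8 by simp
  have \<epsilon>: "\<epsilon> \<le> 1" "\<epsilon> \<le> d3" "\<epsilon> \<le> d4" "\<epsilon> \<le> d8" "\<epsilon> \<le> d1 / C4" "\<epsilon> \<le> d6 / C4" "\<epsilon> \<le> d7 / C4"
    unfolding \<epsilon>_def by (rule Min_le; simp)+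
  have near: "u \<in> overlap" "norm (u - u0) < d3" "norm (u - u0) < d4" "norm (u - u0) \<le> 1"
    "norm (transition u - z0) \<le> C4 * norm (u - u0)" "norm (transition u - z0) < d1"
    "norm (transition u - z0) < d6" "norm (transition u - z0) < d7" if u: "norm (u - u0) < \<epsilon>" for u
  proof -
    have "u \<in> ball u0 d8" using u \<epsilon> by (simp add: dist_norm norm_minus_commute)
    then show "u \<in> overlap" using d8 by blast
    show "norm (u - u0) < d3" "norm (u - u0) < d4" "norm (u - u0) \<le> 1" using u \<epsilon> by auto
    then show le: "norm (transition u - z0) \<le> C4 * norm (u - u0)" by (intro t_Lip)
    have "C4 * norm (u - u0) < C4 * \<epsilon>" using u C4 by simp
    moreover have "C4 * \<epsilon> \<le> d1" "C4 * \<epsilon> \<le> d6" "C4 * \<epsilon> \<le> d7"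
      using \<epsilon> C4 by (simp_all add: pos_le_divide_eq mult.commute)
    ultimately show "norm (transition u - z0) < d1" "norm (transition u - z0) < d6"
      "norm (transition u - z0) < d7" using le by linarith+
  qed
  define K1 where "K1 = C1 * C4 * (C5 + C3) + C2 * C3"
  have "0 < K1" unfolding K1_def using C1 C2 C3 C4 C5 by (intro add_pos_pos mult_pos_pos) auto
  define K where "K = K1 * (C6 / c)\<^sup>2"
  define G where "G = U \<inter> \<phi> -` ball u0 \<epsilon> \<inter> V"
  have "continuous_on U \<phi>" using charts(1) by (simp add: is_chart_def homeomorphism_def)
  then have "open G"
    unfolding G_def using open_U V by (intro open_Int continuous_open_preimage) auto
  moreover have "x \<in> G" using x V \<open>0 < \<epsilon>\<close> by (simp add: G_def u0_def)
  moreover have "L2_inner P v (f y) \<le> K * (L2_norm P (\<lambda>\<omega>. f y \<omega> - f x \<omega>))\<^sup>2"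
    if y: "y \<in> G" "y \<in> M" and v: "v \<in> L2 P" "L2_norm P v = 1" "L2_inner P v (f x) = 0"
      and normal: "\<And>X. X \<in> support_cone A M x \<Longrightarrow> L2_inner P v (D X) = 0" for y v
  proof -
    define w where "w = \<phi> y - u0"
    have w_small: "norm w < \<epsilon>"
      using y(1) by (simp add: G_def w_def dist_norm norm_minus_commute)
    have "\<phi> y \<in> L" using y straight by (auto simp: G_def)
    then have "w \<in> L" unfolding w_def u0_def using L base_in_L by (intro subspace_diff)
    have seg: "norm (u0 + t *\<^sub>R w - u0) \<le> norm w" if "0 \<le> t" "t \<le> 1" for t
      using that by (simp add: mult_left_le_one_le)
    define h where "h t = L2_inner P v (f (param (transition (u0 + t *\<^sub>R w))))" for t
    define h' where "h' t = L2_inner P v (E (transition (u0 + t *\<^sub>R w)) (dtransition (u0 + t *\<^sub>R w) w))" for t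
    have h_deriv: "(h has_real_derivative h' t) (at t)" if "0 \<le> t" "t \<le> 1" for t
    proof -
      let ?u = "u0 + t *\<^sub>R w"
      have u: "norm (?u - u0) < \<epsilon>" using seg[OF that] w_small by linarith
      have in_Z: "transition ?u \<in> ?Z" using near(1)[OF u] by (rule transition_in_image)
      have "((\<lambda>t. u0 + t *\<^sub>R w) has_derivative (\<lambda>s. s *\<^sub>R w)) (at t)"
        by (auto intro!: derivative_eq_intros)
      then have "((\<lambda>t. transition (u0 + t *\<^sub>R w)) has_derivative (\<lambda>s. dtransition ?u (s *\<^sub>R w))) (at t)"
        using transition_derivative[OF near(1)[OF u]] by (rule has_derivative_compose)
      then have "((\<lambda>t. L2_inner P v ((f \<circ> param) (transition (u0 + t *\<^sub>R w)))) has_derivative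
          (\<lambda>s. L2_inner P v (E (transition ?u) (dtransition ?u (s *\<^sub>R w))))) (at t)"
        using L2_has_derivative_inner[OF E[OF in_Z] gL2 v(1)] by (rule has_derivative_compose)
      moreover have "L2_inner P v (E (transition ?u) (dtransition ?u (s *\<^sub>R w))) = h' t * s" for s
        unfolding h'_def
        using linear_scale[OF linear_L2_inner[OF E_lin[OF in_Z] v(1)]]
          linear_scale[OF has_derivative_linear[OF transition_derivative[OF near(1)[OF u]]]] by simp
      ultimately show ?thesis
        by (simp add: has_field_derivative_def h_def[abs_def])
    qed
    obtain \<xi> where \<xi>: "0 < \<xi>" "\<xi> < 1" and mvt: "h 1 - h 0 = (1 - 0) * h' \<xi>"
      using MVT2[of 0 1 h h'] h_deriv by auto
    define u q where "u = u0 + \<xi> *\<^sub>R w" and "q = dtransition u w"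
    define q0 where "q0 = dtransition u0 w"
    have u_le: "norm (u - u0) \<le> norm w" unfolding u_def using \<xi> by (intro seg) auto
    then have u: "norm (u - u0) < \<epsilon>" using w_small by linarith
    have "y \<in> U" using y(1) by (simp add: G_def)
    then have un_y: "unstraighten (u0 + 1 *\<^sub>R w) = y"
      using straight_inverse by (simp add: w_def)
    have y_ov: "\<phi> y \<in> overlap" using near(1)[of "\<phi> y"] w_small by (simp add: w_def)
    have "h 1 = L2_inner P v (f y)"
      using param_transition[OF y_ov] un_y by (simp add: h_def w_def)
    moreover have "h 0 = 0"
      using transition_base param0 v(3) by (simp add: h_def u0_def z0_def)
    ultimately have "L2_inner P v (f y) = h' \<xi>" using mvt by simp
    also have "\<dots> = (L2_inner P v (E (transition u) q) - L2_inner P v (E z0 q)) + L2_inner P v (D (q - q0))"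
    proof -
      have "L2_inner P v (D q0) = 0"
        using \<open>w \<in> L\<close> by (intro normal) (simp add: support_cone_eq q0_def u0_def)
      then have "L2_inner P v (D (q - q0)) = L2_inner P v (E z0 q)"
        using linear_diff[OF linear_L2_inner[OF D_lin v(1)]] E_eq_D[OF v(1)] by simp
      then show ?thesis by (simp add: h'_def u_def q_def)
    qed
    also have "\<dots> \<le> C1 * (C4 * norm w) * ((C5 + C3) * norm w) + C2 * (C3 * norm w * norm w)"
    proof (rule add_mono)
      have q_diff: "norm (q - q0) \<le> C3 * norm w * norm w"
      proof -
        have "norm (q - q0) \<le> C3 * norm (u - u0) * norm w"
          unfolding q_def q0_def using near(1,2)[OF u] by (intro dt_Lip)
        also have "\<dots> \<le> C3 * norm w * norm w"
          using u_le C3 by (intro mult_right_mono mult_left_mono) auto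
        finally show ?thesis .
      qed
      have "norm q \<le> norm q0 + norm (q - q0)" using norm_triangle_ineq[of q0 "q - q0"] by simp
      also have "norm q0 \<le> norm w * C5" unfolding q0_def by (rule C5)
      also note q_diff
      also have "C3 * norm w * norm w \<le> C3 * norm w * 1"
        using w_small \<epsilon> C3 by (intro mult_left_mono) auto
      finally have q_le: "norm q \<le> (C5 + C3) * norm w" by (simp add: algebra_simps)
      have "L2_inner P v (E (transition u) q) - L2_inner P v (E z0 q)
          \<le> C1 * norm (transition u - z0) * norm q * L2_norm P v"
        using E_Lip[OF near(6)[OF u] v(1), of q] by auto
      also have "\<dots> \<le> C1 * (C4 * norm w) * ((C5 + C3) * norm w) * 1"
      proof (intro mult_mono)
        have "norm (transition u - z0) \<le> C4 * norm (u - u0)" using near(5)[OF u] .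
        also have "\<dots> \<le> C4 * norm w" using u_le C4 by (intro mult_left_mono) auto
        finally show "norm (transition u - z0) \<le> C4 * norm w" .
      qed (use C1 C3 C4 C5 v(2) q_le in auto)
      finally show "L2_inner P v (E (transition u) q) - L2_inner P v (E z0 q)
          \<le> C1 * (C4 * norm w) * ((C5 + C3) * norm w)" by simp
      have "L2_inner P v (D (q - q0)) \<le> L2_norm P v * L2_norm P (D (q - q0))"
        using L2_Cauchy_Schwarz[OF v(1) DL2] by (rule order_trans[OF abs_ge_self])
      also have "\<dots> \<le> C2 * norm (q - q0)" using C2 v(2) by simp
      also have "\<dots> \<le> C2 * (C3 * norm w * norm w)" using q_diff C2 by (intro mult_left_mono) auto
      finally show "L2_inner P v (D (q - q0)) \<le> C2 * (C3 * norm w * norm w)" .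
    qed
    also have "\<dots> = K1 * (norm w)\<^sup>2" by (simp add: K1_def power2_eq_square algebra_simps)
    also have "\<dots> \<le> K1 * (C6 / c * L2_norm P (\<lambda>\<omega>. f y \<omega> - f x \<omega>))\<^sup>2"
    proof (intro mult_left_mono power_mono)
      have small: "norm (\<phi> y - u0) < \<epsilon>" using w_small by (simp add: w_def)
      have py: "param (transition (\<phi> y)) = y"
        using param_transition[OF y_ov] un_y by (simp add: w_def)
      have "norm w \<le> C6 * norm (transition (\<phi> y) - z0)"
        using s_Lip[OF near(7)[OF small]] py by (simp add: w_def)
      also have "\<dots> = C6 / c * (c * norm (transition (\<phi> y) - z0))" using c by simp
      also have "\<dots> \<le> C6 / c * L2_norm P (\<lambda>\<omega>. f y \<omega> - f x \<omega>)"
        using expanding[OF near(8)[OF small]] py C6 c by (intro mult_left_mono) auto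
      finally show "norm w \<le> C6 / c * L2_norm P (\<lambda>\<omega>. f y \<omega> - f x \<omega>)" .
    qed (use \<open>0 < K1\<close> in auto)
    also have "\<dots> = K * (L2_norm P (\<lambda>\<omega>. f y \<omega> - f x \<omega>))\<^sup>2"
      by (simp only: K_def power_mult_distrib mult.assoc)
    finally show ?thesis .
  qed
  moreover have "0 < K" unfolding K_def using \<open>0 < K1\<close> C6 c by simp
  ultimately show ?thesis using that by blast
qed

end

section \<open>Trigonometry of the critical radius\<close>

text \<open>With \<open>\<alpha> = arctan a\<close> the inequality reads \<open>cos (s + \<alpha>) > 0\<close>.\<close>

lemma sin_mult_less_cos_iff:
  fixes a s :: real
  assumes "0 \<le> s" "s < pi"
  shows "sin s * a < cos s \<longleftrightarrow> s < pi / 2 - arctan a"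
proof -
  define \<alpha> where "\<alpha> = arctan a"
  have \<alpha>: "- (pi / 2) < \<alpha>" "\<alpha> < pi / 2"
    using arctan_bounded[of a] by (auto simp: \<alpha>_def)
  then have "0 < cos \<alpha>" by (rule cos_gt_zero_pi)
  have "a = sin \<alpha> / cos \<alpha>"
    using tan_arctan[of a] by (simp add: \<alpha>_def tan_def)
  then have "cos \<alpha> * (cos s - sin s * a) = cos (s + \<alpha>)"
    using \<open>0 < cos \<alpha>\<close> by (simp add: cos_add field_simps)
  then have "sin s * a < cos s \<longleftrightarrow> 0 < cos (s + \<alpha>)"
    using zero_less_mult_iff[of "cos \<alpha>" "cos s - sin s * a"] \<open>0 < cos \<alpha>\<close> by simp
  also have "\<dots> \<longleftrightarrow> s + \<alpha> < pi / 2"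
  proof
    assume "s + \<alpha> < pi / 2"
    then show "0 < cos (s + \<alpha>)" using assms \<alpha> by (intro cos_gt_zero_pi) auto
  next
    assume pos: "0 < cos (s + \<alpha>)"
    show "s + \<alpha> < pi / 2"
    proof (rule ccontr)
      assume "\<not> s + \<alpha> < pi / 2"
      then have "0 \<le> cos (pi - (s + \<alpha>))" using assms \<alpha> by (intro cos_ge_zero) auto
      then show False using pos by simp
    qed
  qed
  finally show ?thesis by (simp add: \<alpha>_def algebra_simps)
qed

text \<open>In the direction \<open>v\<close> the angles are those below \<open>arccot (a v y)\<close> for all \<open>y\<close>. Since \<open>arccot\<close> is
  decreasing, the infimum over \<open>v\<close> is \<open>arccot\<close> of the supremum over both \<open>v\<close> and \<open>y\<close>, which is
  the supremum of \<open>H\<close>. If \<open>H\<close> were unbounded the infimum would be \<open>0\<close>, where \<open>cot\<close> takes the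
  default value \<open>0\<close> instead of infinity.\<close>

lemma cot_Inf_Sup_angles:
  fixes a :: "'v \<Rightarrow> 'y \<Rightarrow> real"
  assumes "V \<noteq> {}" "Y \<noteq> {}"
    and bdd: "bdd_above (H ` Y)"
    and nonneg: "\<And>y. y \<in> Y \<Longrightarrow> 0 \<le> H y"
    and le: "\<And>v y. v \<in> V \<Longrightarrow> y \<in> Y \<Longrightarrow> a v y \<le> H y"
    and attained: "\<And>y. y \<in> Y \<Longrightarrow> \<exists>v\<in>V. a v y = H y"
  shows "cot (INF v\<in>V. Sup {t. 0 \<le> t \<and> t < pi \<and> (\<forall>s\<in>{0..t}. \<forall>y\<in>Y. sin s * a v y < cos s)})
    = (SUP y\<in>Y. H y)"
proof -
  define S where "S v = {t. 0 \<le> t \<and> t < pi \<and> (\<forall>s\<in>{0..t}. \<forall>y\<in>Y. sin s * a v y < cos s)}" for v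
  define m where "m = (SUP y\<in>Y. H y)"
  define \<theta> where "\<theta> = pi / 2 - arctan m"
  define I where "I = (INF v\<in>V. Sup (S v))"
  have S_iff: "t \<in> S v \<longleftrightarrow> 0 \<le> t \<and> t < pi \<and> (\<forall>y\<in>Y. t < pi / 2 - arctan (a v y))" for t v
    by (force simp: S_def sin_mult_less_cos_iff)
  have zero: "0 \<in> S v" for v
    using arctan_bounded by (auto simp: S_iff)
  have bdd_S: "bdd_above (S v)" for v
    by (rule bdd_aboveI[of _ pi]) (auto simp: S_def)
  have H_le: "H y \<le> m" if "y \<in> Y" for y
    unfolding m_def using bdd that by (rule cSUP_upper2) simp
  obtain y0 where "y0 \<in> Y" using \<open>Y \<noteq> {}\<close> by blast
  have "0 \<le> m" using nonneg H_le \<open>y0 \<in> Y\<close> by fastforce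
  have \<theta>: "0 < \<theta>" "\<theta> \<le> pi / 2"
    using arctan_bounded[of m] \<open>0 \<le> m\<close> by (auto simp: \<theta>_def)
  have lower: "\<theta> \<le> Sup (S v)" if "v \<in> V" for v
  proof (rule dense_le_bounded[OF \<theta>(1)])
    fix t assume t: "0 < t" "t < \<theta>"
    have "t < pi / 2 - arctan (a v y)" if "y \<in> Y" for y
    proof -
      have "arctan (a v y) \<le> arctan m"
        using le[OF \<open>v \<in> V\<close> that] H_le[OF that] by (simp add: arctan_le_iff)
      then show ?thesis using t by (simp add: \<theta>_def)
    qed
    moreover have "t < pi" using t \<theta> pi_gt_zero by linarith
    ultimately have "t \<in> S v" using t by (simp add: S_iff)
    then show "t \<le> Sup (S v)" by (intro cSup_upper bdd_S)
  qed
  have "\<theta> \<le> I"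
    unfolding I_def using \<open>V \<noteq> {}\<close> lower by (rule cINF_greatest)
  have bdd_I: "bdd_below ((\<lambda>v. Sup (S v)) ` V)"
    using lower by (rule bdd_belowI2)
  have upper: "arctan (H y) \<le> pi / 2 - I" if y: "y \<in> Y" for y
  proof -
    obtain v where v: "v \<in> V" "a v y = H y" using attained[OF y] by blast
    have "I \<le> Sup (S v)"
      unfolding I_def using bdd_I v(1) by (rule cINF_lower)
    also have "\<dots> \<le> pi / 2 - arctan (H y)"
      using zero[of v] v y by (intro cSup_least) (blast, force simp: S_iff)
    finally show ?thesis by simp
  qed
  have "0 \<le> arctan (H y0)" using nonneg[OF \<open>y0 \<in> Y\<close>] by simp
  then have I: "0 \<le> pi / 2 - I" "pi / 2 - I < pi / 2"
    using upper[OF \<open>y0 \<in> Y\<close>] \<open>\<theta> \<le> I\<close> \<theta> by linarith+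
  have arctan_tan_I: "arctan (tan (pi / 2 - I)) = pi / 2 - I" using I by (intro arctan_tan) auto
  have "H y \<le> tan (pi / 2 - I)" if "y \<in> Y" for y
    using upper[OF that] by (subst arctan_le_iff[symmetric]) (simp only: arctan_tan_I)
  then have "m \<le> tan (pi / 2 - I)"
    unfolding m_def by (intro cSUP_least \<open>Y \<noteq> {}\<close>)
  then have "arctan m \<le> arctan (tan (pi / 2 - I))" by (rule arctan_monotone')
  also have "\<dots> = pi / 2 - I" by (rule arctan_tan_I)
  finally have "I = \<theta>" using \<open>\<theta> \<le> I\<close> by (simp add: \<theta>_def)
  then have "cot I = tan (arctan m)"
    by (simp add: \<theta>_def cot_def tan_def sin_diff cos_diff)
  then show ?thesis
    by (simp add: I_def S_def m_def tan_arctan)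
qed

section \<open>The process in the normal directions\<close>

locale embedded_process =
  fixes A :: "('m::{t2_space, second_countable_topology}, 'e::euclidean_space) chart set"
    and P :: "'w measure"
    and f :: "'m \<Rightarrow> 'w \<Rightarrow> real"
    and M :: "'m set"
    and bM :: "nat \<Rightarrow> 'm set"
    and k :: nat
    and x :: 'm
  assumes atlas: "Ck_atlas 3 A"
    and piecewise: "piecewise_C2_submanifold A k bM M"
    and gaussian: "gaussian_process P f"
    and standard: "centered_unit_variance P f"
    and embedding: "C2_embedding A P f"
    and top_stratum: "x \<in> bM k"
begin

definition D :: "'e \<Rightarrow> 'w \<Rightarrow> real" where "D = dproc A P f x"

definition g :: "'e \<Rightarrow> 'e \<Rightarrow> real" where "g = metric_g A P f x"

definition T :: "'e set" where "T = support_cone A M x"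

definition \<rho> :: "'m \<Rightarrow> real" where "\<rho> y = L2_inner P (f x) (f y)"

text \<open>The direction whose derivative is subtracted in the definition of the process \<open>f\<^sup>x\<close>.\<close>

definition tangential :: "'m \<Rightarrow> 'e" where
  "tangential y = F_hat A P f x y - proj_normal A P f M x (F_hat A P f x y)"

text \<open>The numerator of \<open>f\<^sup>x(y)\<close>.\<close>

definition normal_part :: "'m \<Rightarrow> 'w \<Rightarrow> real" where
  "normal_part y = (\<lambda>\<omega>. f y \<omega> - \<rho> y * f x \<omega> - g (tangential y) (gradient A P f x \<omega>))"

definition normals :: "('w \<Rightarrow> real) set" where "normals = unit_normals A P f (bM k) x"

sublocale prob_space P
  using gaussian by (simp add: gaussian_process_def)

lemma f_H: "f y \<in> H_space P f"
  using embedding by (simp add: C2_embedding_def)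

lemma f_L2: "f y \<in> L2 P"
  using f_H by (rule H_space_L2)

lemma mean_zero: "X \<in> H_space P f \<Longrightarrow> (\<integral>\<omega>. X \<omega> \<partial>P) = 0"
  using H_space_mean_zero[OF prob_space_axioms f_L2] standard by (simp add: centered_unit_variance_def)

lemma cov_eq: "X \<in> H_space P f \<Longrightarrow> Y \<in> H_space P f \<Longrightarrow> cov P X Y = L2_inner P X Y"
  by (simp add: cov_def mean_zero L2_inner_def)

lemma norm_f: "L2_norm P (f y) = 1"
proof -
  have "variance (f y) = 1" using standard unfolding centered_unit_variance_def by blast
  then show ?thesis
    by (simp add: mean_zero[OF f_H] L2_norm_def L2_inner_def power2_eq_square)
qed

lemma cor_eq: "cor P (f x) (f y) = \<rho> y"
proof -
  have "variance (f z) = 1" for z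
    using standard unfolding centered_unit_variance_def by blast
  then show ?thesis by (simp add: cor_def cov_eq f_H \<rho>_def)
qed

lemma dist_square: "(L2_norm P (\<lambda>\<omega>. f y \<omega> - f x \<omega>))\<^sup>2 = 2 * (1 - \<rho> y)"
  by (simp add: L2_norm_diff_square f_L2 norm_f \<rho>_def L2_inner_commute[of P "f y"])

lemma rho_less_1:
  assumes "y \<noteq> x"
  shows "\<rho> y < 1"
proof -
  have "L2_norm P (\<lambda>\<omega>. f y \<omega> - f x \<omega>) \<noteq> 0"
    using embedding assms by (auto simp: C2_embedding_def)
  then have "0 < (L2_norm P (\<lambda>\<omega>. f y \<omega> - f x \<omega>))\<^sup>2" by simp
  then show ?thesis by (simp add: dist_square)
qed

lemma straightening:
  obtains V U \<phi> L where "straightening_chart A M V U x \<phi> L"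
proof -
  have "x \<in> manifold_interior A k M"
    using piecewise top_stratum by (simp add: piecewise_C2_submanifold_def)
  then obtain V where V: "x \<in> M" "open V" "x \<in> V" and sub: "C2_submanifold A k (M \<inter> V)"
    by (auto simp: manifold_interior_def)
  have "x \<in> M \<inter> V" using V by simp
  then obtain U \<phi> L where "x \<in> U" "Ck_diffeo A 2 U \<phi>" "subspace L" "\<phi> ` (U \<inter> (M \<inter> V)) = \<phi> ` U \<inter> L"
    using sub unfolding C2_submanifold_def by meson
  then have "straightening_chart A M V U x \<phi> L"
    using V atlas by unfold_locales
  then show ?thesis by (rule that)
qed

lemma subspace_T: "subspace T"
  unfolding T_def using straightening straightening_chart.subspace_support_cone by metis

lemma tangent_eq_T: "tangent_of A (bM k) x = T"
proof -
  have "largest_subspace_of T (tangent_of A (bM k) x)"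
    using piecewise top_stratum unfolding piecewise_C2_submanifold_def T_def by blast
  then show ?thesis using subspace_T by (auto simp: largest_subspace_of_def)
qed

lemma chart_at_x: "chart_at A x \<in> A" "x \<in> fst (chart_at A x)"
proof -
  obtain V U \<phi> L where "straightening_chart A M V U x \<phi> L" by (rule straightening)
  then interpret straightening_chart A M V U x \<phi> L .
  show "chart_at A x \<in> A" "x \<in> fst (chart_at A x)"
    using chart_at_in by (simp_all add: chart_dom_def)
qed

lemma smooth: "L2_Ck_on 2 P (f \<circ> chart_inv (chart_at A x)) (snd (chart_at A x) ` fst (chart_at A x))"
  using embedding chart_at_x by (simp add: C2_embedding_def)

lemma D_derivative: "L2_has_derivative P (f \<circ> chart_inv (chart_at A x)) D (snd (chart_at A x) x)"
proof -
  have "\<exists>E. L2_has_derivative P (f \<circ> chart_inv (chart_at A x)) E (snd (chart_at A x) x)"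
    using smooth chart_at_x by (auto simp: numeral_2_eq_2)
  then show ?thesis unfolding D_def dproc_def by (rule someI_ex)
qed

lemma D_linear: "L2_linear P D"
  using D_derivative by (rule L2_has_derivative_linear)

lemma D_H: "D X \<in> H_space P f"
  using f_L2 D_derivative by (rule H_space_derivative) (simp add: f_H)

lemma D_L2: "D X \<in> L2 P"
  using D_H by (rule H_space_L2)

lemma immersion: "L2_norm P (D X) = 0 \<Longrightarrow> X = 0"
  using embedding by (auto simp: C2_embedding_def D_def)

lemma linear_inner_D: "Z \<in> L2 P \<Longrightarrow> linear (\<lambda>X. L2_inner P Z (D X))"
  using D_linear by (rule linear_L2_inner)

lemma g_eq: "g X Y = L2_inner P (D X) (D Y)"
  by (simp add: g_def metric_g_def cov_eq D_H flip: D_def)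

sublocale positive_definite_form g
proof
  show "bilinear g"
    using bilinear_L2_inner[OF D_linear] by (simp add: g_eq[abs_def])
  show "g X Y = g Y X" for X Y
    by (simp add: g_eq L2_inner_commute)
  show "0 < g X X" if "X \<noteq> 0" for X
  proof -
    have "L2_norm P (D X) \<noteq> 0" using immersion that by blast
    then have "0 < (L2_norm P (D X))\<^sup>2" by simp
    then show ?thesis by (simp add: g_eq L2_norm_square)
  qed
qed

text \<open>The correlation with \<open>f x\<close> is largest at \<open>x\<close>, so its differential vanishes there.\<close>

lemma f_orthogonal_D: "L2_inner P (f x) (D X) = 0"
proof -
  let ?h = "\<lambda>z. L2_inner P (f x) ((f \<circ> chart_inv (chart_at A x)) z)"
  let ?z = "snd (chart_at A x) x"
  have der: "(?h has_derivative (\<lambda>X. L2_inner P (f x) (D X))) (at ?z)"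
    using D_derivative by (rule L2_has_derivative_inner) (simp_all add: f_L2)
  have "is_chart (chart_at A x)" using atlas chart_at_x by (simp add: Ck_atlas_def)
  then have "chart_inv (chart_at A x) ?z = x"
    using is_chart_inverse(1)[of "fst (chart_at A x)" "snd (chart_at A x)" x] chart_at_x by simp
  then have "?h ?z = 1"
    using norm_f[of x] L2_norm_square[of P "f x"] by simp
  moreover have "?h z \<le> 1" for z
    using L2_Cauchy_Schwarz[OF f_L2 f_L2, of x "chart_inv (chart_at A x) z"] by (simp add: norm_f)
  ultimately have "(\<lambda>X. L2_inner P (f x) (D X)) = (\<lambda>X. 0)"
    using differential_zero_maxmin[of ?z UNIV ?h] der by simp
  then show ?thesis by (rule fun_cong)
qed

lemma frame: "orthonormal (frame A P f x)" "span (frame A P f x) = UNIV"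
proof -
  obtain B where "orthonormal B" "span B = UNIV"
    using orthonormal_basis_exists[OF subspace_UNIV] by blast
  then have "orthonormal_basis A P f x B"
    by (simp add: orthonormal_basis_def orthonormal_def flip: g_def)
  then have "orthonormal_basis A P f x (frame A P f x)"
    unfolding frame_def by (rule someI)
  then show "orthonormal (frame A P f x)" "span (frame A P f x) = UNIV"
    by (simp_all add: orthonormal_basis_def orthonormal_def flip: g_def)
qed

lemma frame_expansion: "(\<Sum>Y\<in>frame A P f x. g X Y *\<^sub>R Y) = X"
  using orthonormal_expansion[OF frame, of X] by simp

lemma inner_D_expansion:
  assumes "Z \<in> L2 P"
  shows "(\<Sum>Y\<in>frame A P f x. g X Y * L2_inner P Z (D Y)) = L2_inner P Z (D X)"
proof -
  have "L2_inner P Z (D X) = L2_inner P Z (D (\<Sum>Y\<in>frame A P f x. g X Y *\<^sub>R Y))"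
    by (simp add: frame_expansion)
  also have "\<dots> = (\<Sum>Y\<in>frame A P f x. g X Y * L2_inner P Z (D Y))"
    using linear_sum[OF linear_inner_D[OF assms], of "\<lambda>Y. g X Y *\<^sub>R Y"] linear_scale[OF linear_inner_D[OF assms]]
    by simp
  finally show ?thesis by simp
qed

lemma g_F_field: "g (F_field A P f x y) X = L2_inner P (f y) (D X)"
proof -
  have "g (F_field A P f x y) X = (\<Sum>Y\<in>frame A P f x. L2_inner P (f y) (D Y) * g Y X)"
    unfolding F_field_def
    by (simp add: linear_sum[OF linear_left] linear_scale[OF linear_left] cov_eq f_H D_H flip: D_def)
  also have "\<dots> = (\<Sum>Y\<in>frame A P f x. g X Y * L2_inner P (f y) (D Y))"
    by (intro sum.cong refl) (simp add: symmetric[of _ X] mult.commute)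
  finally show ?thesis by (simp add: inner_D_expansion f_L2)
qed

lemma g_F_hat: "g (F_hat A P f x y) X = L2_inner P (f y) (D X)"
  by (simp add: F_hat_def linear_diff[OF linear_left] linear_scale[OF linear_left] g_F_field f_orthogonal_D)

text \<open>At an interior point the support cone is a linear space, the normal cone its orthogonal
  complement, and subtracting the projection to the normal cone leaves the tangential component.\<close>

lemma tangential:
  shows "tangential y \<in> T" and "X \<in> T \<Longrightarrow> g (tangential y) X = L2_inner P (f y) (D X)"
proof -
  obtain a b where ab: "F_hat A P f x y = a + b" "a \<in> T" "\<And>Y. Y \<in> T \<Longrightarrow> g b Y = 0"
    using orthogonal_decomposition[OF subspace_T] by metis
  have "normal_cone A P f M x = {Z. \<forall>Y\<in>T. g Z Y = 0}"
  proof (intro equalityI subsetI CollectI ballI)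
    fix Z Y assume "Z \<in> normal_cone A P f M x" "Y \<in> T"
    moreover from \<open>Y \<in> T\<close> have "- Y \<in> T" using subspace_T by (simp add: subspace_neg)
    ultimately have "g Z Y \<le> 0" "g Z (- Y) \<le> 0"
      by (auto simp: normal_cone_def g_def T_def)
    then show "g Z Y = 0" by (simp add: linear_neg[OF linear_right])
  qed (simp add: normal_cone_def T_def g_def)
  then have "proj_normal A P f M x (a + b) = b"
    using nearest_point_orthogonal_complement[OF ab(2,3)] by (simp add: proj_normal_def g_def)
  then have "tangential y = a" by (simp add: tangential_def ab(1))
  then show "tangential y \<in> T" using ab(2) by simp
  show "g (tangential y) X = L2_inner P (f y) (D X)" if "X \<in> T"
    using g_F_hat[of y X] ab(3)[OF that] \<open>tangential y = a\<close>
    by (simp add: ab(1) linear_add[OF linear_left])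
qed

lemma g_gradient: "g X (gradient A P f x \<omega>) = (\<Sum>Y\<in>frame A P f x. g X Y * D Y \<omega>)"
  by (simp add: gradient_def linear_sum[OF linear_right] linear_scale[OF linear_right] mult.commute
      flip: D_def)

lemma gradient_H: "(\<lambda>\<omega>. g X (gradient A P f x \<omega>)) \<in> H_space P f"
  unfolding g_gradient by (intro H_space_sum H_space_scale f_L2 D_H)

lemma inner_gradient:
  assumes "Z \<in> L2 P"
  shows "L2_inner P Z (\<lambda>\<omega>. g X (gradient A P f x \<omega>)) = L2_inner P Z (D X)"
  unfolding g_gradient
  using assms by (simp add: L2_inner_sum_right L2_scale D_L2 L2_inner_scale_right inner_D_expansion)

lemma normal_part_H: "normal_part y \<in> H_space P f"
  unfolding normal_part_def by (intro H_space_diff H_space_scale gradient_H f_L2 f_H)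

lemma inner_normal_part:
  assumes "Z \<in> L2 P"
  shows "L2_inner P Z (normal_part y)
    = L2_inner P Z (f y) - \<rho> y * L2_inner P Z (f x) - L2_inner P Z (D (tangential y))"
  unfolding normal_part_def using assms H_space_L2[OF gradient_H]
  by (simp add: L2_inner_diff_right L2_intros f_L2 L2_inner_scale_right inner_gradient)

lemma normal_part_orthogonal:
  shows "L2_inner P (normal_part y) (f x) = 0"
    and "X \<in> T \<Longrightarrow> L2_inner P (normal_part y) (D X) = 0"
proof -
  have "L2_inner P (f x) (f x) = 1" using norm_f[of x] L2_norm_square[of P "f x"] by simp
  then show "L2_inner P (normal_part y) (f x) = 0"
    by (subst L2_inner_commute) (simp add: inner_normal_part f_L2 f_orthogonal_D \<rho>_def)
  assume X: "X \<in> T"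
  have "L2_inner P (D X) (D (tangential y)) = L2_inner P (D X) (f y)"
    using tangential(2)[OF X, of y] by (simp add: g_eq L2_inner_commute)
  then show "L2_inner P (normal_part y) (D X) = 0"
    by (subst L2_inner_commute)
      (simp add: inner_normal_part D_L2 L2_inner_commute[of P "D X" "f x"] f_orthogonal_D)
qed

lemma normals_iff: "v \<in> normals \<longleftrightarrow> v \<in> H_space P f \<and> L2_norm P v = 1 \<and> L2_inner P v (f x) = 0 \<and>
    (\<forall>X\<in>T. L2_inner P v (D X) = 0)"
  by (simp add: normals_def unit_normals_def tangent_eq_T flip: D_def)

lemma normals_L2: "v \<in> normals \<Longrightarrow> v \<in> L2 P"
  using H_space_L2 by (auto simp: normals_iff)

lemma inner_normal:
  assumes "v \<in> normals"
  shows "L2_inner P v (f y) = L2_inner P v (normal_part y)"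
  using assms tangential(1) normals_L2[OF assms] by (simp add: normals_iff inner_normal_part)

lemma inner_normal_le:
  assumes "v \<in> normals"
  shows "L2_inner P v (f y) \<le> L2_norm P (normal_part y)"
  using L2_Cauchy_Schwarz[OF normals_L2[OF assms] H_space_L2[OF normal_part_H], of y] assms
  by (simp add: inner_normal[OF assms] normals_iff)

lemma normalised_normal_part:
  assumes "L2_norm P (normal_part y) \<noteq> 0"
  obtains v where "v \<in> normals" "L2_inner P v (f y) = L2_norm P (normal_part y)"
proof -
  define c where "c = L2_norm P (normal_part y)"
  have c: "c \<noteq> 0" "0 \<le> c" using assms by (simp_all add: c_def)
  define v where "v = (\<lambda>\<omega>. (1 / c) * normal_part y \<omega>)"
  have "L2_norm P v = 1"
    unfolding v_def L2_norm_scale using c by (simp flip: c_def)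
  moreover have "v \<in> H_space P f" unfolding v_def by (rule H_space_scale[OF normal_part_H])
  moreover have "L2_inner P v (f x) = 0" "L2_inner P v (D X) = 0" if "X \<in> T" for X
    unfolding v_def L2_inner_scale_left using that by (simp_all add: normal_part_orthogonal)
  ultimately have v: "v \<in> normals"
    using subspace_0[OF subspace_T] by (auto simp: normals_iff)
  moreover have "L2_inner P v (f y) = c"
  proof -
    have "L2_inner P v (f y) = (1 / c) * L2_inner P (normal_part y) (normal_part y)"
      by (subst inner_normal[OF v]) (simp only: v_def L2_inner_scale_left)
    also have "L2_inner P (normal_part y) (normal_part y) = c * c"
      using L2_norm_square[of P "normal_part y"] by (simp add: c_def power2_eq_square)
    finally show ?thesis using c by simp
  qed
  ultimately show ?thesis using that by (simp add: c_def)
qed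

lemma variance_f_sup:
  assumes "y \<noteq> x"
  shows "variance (f_sup A P f M x y) = (L2_norm P (normal_part y) / (1 - \<rho> y))\<^sup>2"
proof -
  have f_sup: "f_sup A P f M x y = (\<lambda>\<omega>. (1 / (1 - \<rho> y)) * normal_part y \<omega>)"
    by (simp add: fun_eq_iff f_sup_def cor_eq normal_part_def tangential_def g_def)
  then have "f_sup A P f M x y \<in> H_space P f" by (simp only: H_space_scale normal_part_H)
  then have "variance (f_sup A P f M x y) = (L2_norm P (f_sup A P f M x y))\<^sup>2"
    by (simp only: mean_zero L2_norm_square) (simp add: L2_inner_def power2_eq_square)
  also have "L2_norm P (f_sup A P f M x y) = L2_norm P (normal_part y) / (1 - \<rho> y)"
    unfolding f_sup L2_norm_scale using rho_less_1[OF assms] by simp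
  finally show ?thesis .
qed

text \<open>Near \<open>x\<close> the bound comes from the second order contact of \<open>f\<close> with the normal directions, since \<open>1 - \<rho> y\<close> is half the squared distance from
  \<open>f x\<close> to \<open>f y\<close>. Away from \<open>x\<close> that distance is bounded below, because \<open>f\<close> is an embedding.\<close>

lemma normal_part_quotient_bounded:
  "bdd_above ((\<lambda>y. L2_norm P (normal_part y) / (1 - \<rho> y)) ` (M - {x}))"
proof -
  obtain V U \<phi> L where "straightening_chart A M V U x \<phi> L" by (rule straightening)
  then interpret straightening_chart A M V U x \<phi> L .
  have smooth': "L2_Ck_on 2 P (f \<circ> param) (coord ` chart_dom)"
    using smooth by (simp add: param_def coord_def chart_dom_def)
  have D_derivative': "L2_has_derivative P (f \<circ> param) D (coord x)"
    using D_derivative by (simp add: param_def coord_def)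
  obtain K G where K: "0 < K" "open G" "x \<in> G" and
    contact: "\<And>y v. y \<in> G \<Longrightarrow> y \<in> M \<Longrightarrow> v \<in> L2 P \<Longrightarrow> L2_norm P v = 1 \<Longrightarrow> L2_inner P v (f x) = 0 \<Longrightarrow>
      (\<And>X. X \<in> T \<Longrightarrow> L2_inner P v (D X) = 0) \<Longrightarrow>
      L2_inner P v (f y) \<le> K * (L2_norm P (\<lambda>\<omega>. f y \<omega> - f x \<omega>))\<^sup>2"
    using second_order_contact[OF f_L2 smooth' D_derivative' immersion] unfolding T_def by blast
  obtain \<epsilon> where \<epsilon>: "0 < \<epsilon>" "\<And>y. L2_norm P (\<lambda>\<omega>. f y \<omega> - f x \<omega>) < \<epsilon> \<Longrightarrow> y \<in> G"
    using embedding K unfolding C2_embedding_def by meson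
  have "L2_norm P (normal_part y) / (1 - \<rho> y) \<le> max (2 * K) (2 / \<epsilon>\<^sup>2)" if y: "y \<in> M - {x}" for y
  proof (cases "L2_norm P (normal_part y) = 0")
    case True
    then show ?thesis using K(1) by (simp add: le_max_iff_disj)
  next
    case False
    have "0 < 1 - \<rho> y" using rho_less_1 y by simp
    obtain v where v: "v \<in> normals" "L2_inner P v (f y) = L2_norm P (normal_part y)"
      using False by (rule normalised_normal_part)
    show ?thesis
    proof (cases "y \<in> G")
      case True
      then have "L2_norm P (normal_part y) \<le> K * (L2_norm P (\<lambda>\<omega>. f y \<omega> - f x \<omega>))\<^sup>2"
        using contact[OF True _ normals_L2[OF v(1)]] v y by (simp add: normals_iff)
      then have "L2_norm P (normal_part y) / (1 - \<rho> y) \<le> 2 * K"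
        using \<open>0 < 1 - \<rho> y\<close> by (simp add: dist_square pos_divide_le_eq ac_simps)
      then show ?thesis by (simp add: le_max_iff_disj)
    next
      case False
      then have "\<epsilon> \<le> L2_norm P (\<lambda>\<omega>. f y \<omega> - f x \<omega>)" using \<epsilon>(2)[of y] by (meson not_less)
      then have "\<epsilon>\<^sup>2 \<le> 2 * (1 - \<rho> y)"
        unfolding dist_square[symmetric] using \<epsilon>(1) by (intro power_mono) auto
      moreover have "L2_norm P (normal_part y) \<le> 1"
        using L2_Cauchy_Schwarz[OF normals_L2[OF v(1)] f_L2, of y] v by (simp add: normals_iff norm_f)
      ultimately have "L2_norm P (normal_part y) / (1 - \<rho> y) \<le> 1 / (\<epsilon>\<^sup>2 / 2)"
        using \<epsilon>(1) by (intro frac_le) auto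
      then show ?thesis by (simp add: le_max_iff_disj)
    qed
  qed
  then show ?thesis by (rule bdd_aboveI2)
qed

section \<open>Closest points along normal geodesics\<close>

lemma unique_closest_iff:
  assumes v: "v \<in> normals" and s: "0 \<le> s" "s \<le> pi"
  shows "unique_closest P (f ` M) (sphere_geodesic (f x) v s) (f x) \<longleftrightarrow>
    (\<forall>y\<in>M - {x}. sin s * (L2_inner P v (f y) / (1 - \<rho> y)) < cos s)"
proof -
  let ?c = "sphere_geodesic (f x) v s"
  have vL: "v \<in> L2 P" and v_norm: "L2_norm P v = 1" and v_orth: "L2_inner P v (f x) = 0"
    using v normals_L2 by (simp_all add: normals_iff)
  have f_self: "L2_inner P (f x) (f x) = 1" using norm_f[of x] L2_norm_square[of P "f x"] by simp
  have cL: "?c \<in> L2 P" unfolding sphere_geodesic_def using vL f_L2 by (intro L2_intros)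
  have inner_c: "L2_inner P ?c (f y) = cos s * \<rho> y + sin s * L2_inner P v (f y)" for y
    unfolding sphere_geodesic_def \<rho>_def using vL f_L2
    by (simp add: L2_inner_add_left L2_intros L2_inner_scale_left)
  have "(L2_norm P ?c)\<^sup>2 = (cos s)\<^sup>2 + (sin s)\<^sup>2"
    unfolding sphere_geodesic_def using vL f_L2
    by (subst L2_norm_add_square)
      (simp_all add: L2_intros L2_norm_scale L2_inner_scale_left L2_inner_scale_right norm_f v_norm
        L2_inner_commute[of P "f x" v] v_orth)
  then have c_norm: "L2_norm P ?c = 1" using L2_norm_nonneg[of P ?c] by (simp add: power2_eq_1_iff)
  have bound: "\<bar>L2_inner P ?c (f y)\<bar> \<le> 1" for y
    using L2_Cauchy_Schwarz[OF cL f_L2, of y] by (simp add: c_norm norm_f)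
  have distinct: "L2_norm P (\<lambda>\<omega>. f y \<omega> - f x \<omega>) \<noteq> 0 \<longleftrightarrow> y \<noteq> x" for y
    using embedding dist_square[of x] f_self by (auto simp: C2_embedding_def \<rho>_def)
  have "sphere_dist P ?c (f x) < sphere_dist P ?c (f y) \<longleftrightarrow> sin s * (L2_inner P v (f y) / (1 - \<rho> y)) < cos s"
    if "y \<noteq> x" for y
  proof -
    have "sphere_dist P ?c (f x) < sphere_dist P ?c (f y) \<longleftrightarrow> L2_inner P ?c (f y) < L2_inner P ?c (f x)"
      unfolding sphere_dist_def using bound[of x] bound[of y] by (rule arccos_less_mono)
    also have "\<dots> \<longleftrightarrow> sin s * L2_inner P v (f y) < cos s * (1 - \<rho> y)"
      using v_orth f_self by (simp add: inner_c \<rho>_def algebra_simps)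
    also have "\<dots> \<longleftrightarrow> sin s * (L2_inner P v (f y) / (1 - \<rho> y)) < cos s"
      using rho_less_1[OF that] by (simp add: pos_divide_less_eq)
    finally show ?thesis .
  qed
  then show ?thesis by (auto simp: unique_closest_def distinct)
qed

lemma critical_radius_dir_eq:
  assumes "v \<in> normals"
  shows "critical_radius_dir P (f ` M) (f x) v = Sup {t. 0 \<le> t \<and> t < pi \<and>
    (\<forall>s\<in>{0..t}. \<forall>y\<in>M - {x}. sin s * (L2_inner P v (f y) / (1 - \<rho> y)) < cos s)}"
  unfolding critical_radius_dir_def
  by (intro arg_cong[of _ _ Sup] Collect_cong conj_cong refl ball_cong unique_closest_iff[OF assms]) auto

text \<open>The degenerate cases agree because \<open>cot (pi / 2) = 0\<close> and, by the convention on division by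
  zero, \<open>cot pi = 0\<close>: without normals the process \<open>f\<^sup>x\<close> vanishes almost surely, and if \<open>M\<close> is a single point
  every critical radius is \<open>pi\<close>.\<close>

lemma critical_variance_eq_cot:
  "critical_variance A P f M x = ennreal ((cot (local_critical_radius A P f M (bM k) x))\<^sup>2)"
proof -
  define H where "H y = L2_norm P (normal_part y) / (1 - \<rho> y)" for y
  have H_nonneg: "0 \<le> H y" if "y \<in> M - {x}" for y
    using rho_less_1[of y] that by (simp add: H_def)
  have variance: "critical_variance A P f M x = (SUP y\<in>M - {x}. ennreal ((H y)\<^sup>2))"
    unfolding critical_variance_def H_def by (intro SUP_cong refl) (simp add: variance_f_sup)
  have radius: "local_critical_radius A P f M (bM k) x = (if normals = {} then pi / 2
      else INF v\<in>normals. critical_radius_dir P (f ` M) (f x) v)"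
    by (simp add: local_critical_radius_def normals_def)
  show ?thesis
  proof (cases "M - {x} = {}")
    case True
    have "Sup {t::real. 0 \<le> t \<and> t < pi} = pi"
      using cSup_atLeastLessThan[of 0 pi] by (simp add: atLeastLessThan_def atLeast_def lessThan_def Int_def)
    then have "critical_radius_dir P (f ` M) (f x) v = pi" if "v \<in> normals" for v
      unfolding critical_radius_dir_eq[OF that] True by simp
    then have "cot (local_critical_radius A P f M (bM k) x) = 0"
      by (simp add: radius cot_def)
    then show ?thesis unfolding variance True by (simp add: bot_ennreal)
  next
    case nonempty: False
    show ?thesis
    proof (cases "normals = {}")
      case True
      then have "H y = 0" for y
        using normalised_normal_part[of y] by (auto simp: H_def)
      then show ?thesis using nonempty True by (simp add: variance radius cot_def)
    next
      case False
      define m where "m = (SUP y\<in>M - {x}. H y)"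
      have bdd: "bdd_above (H ` (M - {x}))"
        using normal_part_quotient_bounded by (simp add: H_def[abs_def])
      have "cot (local_critical_radius A P f M (bM k) x)
          = cot (INF v\<in>normals. Sup {t. 0 \<le> t \<and> t < pi \<and>
              (\<forall>s\<in>{0..t}. \<forall>y\<in>M - {x}. sin s * (L2_inner P v (f y) / (1 - \<rho> y)) < cos s)})"
        using False by (simp add: radius critical_radius_dir_eq cong: INF_cong_simp)
      also have "\<dots> = m"
        unfolding m_def
      proof (rule cot_Inf_Sup_angles[OF False nonempty bdd H_nonneg])
        fix v y assume v: "v \<in> normals" and "y \<in> M - {x}"
        then show "L2_inner P v (f y) / (1 - \<rho> y) \<le> H y"
          unfolding H_def using inner_normal_le[OF v] rho_less_1 by (intro divide_right_mono) (auto simp: less_imp_le)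
      next
        fix y
        have "\<exists>v\<in>normals. L2_inner P v (f y) = L2_norm P (normal_part y)"
        proof (cases "L2_norm P (normal_part y) = 0")
          case True
          obtain v where v: "v \<in> normals" using False by blast
          have "\<bar>L2_inner P v (normal_part y)\<bar> \<le> 0"
            using L2_Cauchy_Schwarz[OF normals_L2[OF v] H_space_L2[OF normal_part_H], of y] True by simp
          then show ?thesis using v True inner_normal[OF v, of y] by auto
        next
          case False
          then show ?thesis using normalised_normal_part by blast
        qed
        then show "\<exists>v\<in>normals. L2_inner P v (f y) / (1 - \<rho> y) = H y"
          by (auto simp: H_def)
      qed
      finally have cot_m: "cot (local_critical_radius A P f M (bM k) x) = m" .
      have "(SUP y\<in>M - {x}. ennreal ((H y)\<^sup>2)) = ennreal (m\<^sup>2)"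
      proof (rule antisym)
        show "(SUP y\<in>M - {x}. ennreal ((H y)\<^sup>2)) \<le> ennreal (m\<^sup>2)"
        proof (rule SUP_least)
          fix y assume y: "y \<in> M - {x}"
          then have "H y \<le> m" unfolding m_def using bdd by (rule cSUP_upper)
          then show "ennreal ((H y)\<^sup>2) \<le> ennreal (m\<^sup>2)"
            using H_nonneg[OF y] by (intro ennreal_leI power_mono)
        qed
        define S where "S = (SUP y\<in>M - {x}. ennreal ((H y)\<^sup>2))"
        have upper: "ennreal ((H y)\<^sup>2) \<le> S" if "y \<in> M - {x}" for y
          unfolding S_def using that by (rule SUP_upper)
        show "ennreal (m\<^sup>2) \<le> S"
        proof (cases S)
          case (real r)
          have "H y \<le> sqrt r" if "y \<in> M - {x}" for y
            using upper[OF that] real by (intro real_le_rsqrt) simp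
          then have "m \<le> sqrt r" unfolding m_def using nonempty by (intro cSUP_least)
          moreover obtain y0 where y0: "y0 \<in> M - {x}" using nonempty by blast
          then have "H y0 \<le> m" unfolding m_def using bdd by (rule cSUP_upper)
          then have "0 \<le> m" using H_nonneg[OF y0] by simp
          ultimately have "m\<^sup>2 \<le> (sqrt r)\<^sup>2" by (intro power_mono)
          then show ?thesis using real by simp
        qed simp
      qed
      then show ?thesis by (simp add: variance cot_m)
    qed
  qed
qed

end

theorem lemma5p1:
  fixes A :: "('m::{t2_space, second_countable_topology}, 'e::euclidean_space) chart set"
    and P :: "'w measure"
    and fhat :: "'m \<Rightarrow> 'w \<Rightarrow> real"
    and M :: "'m set"
    and bM :: "nat \<Rightarrow> 'm set"
    and k :: nat
    and x :: 'm
  assumes "Ck_atlas 3 A"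
    and "compact M"
    and "piecewise_C2_submanifold A k bM M"
    and "gaussian_process P fhat"
    and "centered_unit_variance P fhat"
    and "C2_embedding A P fhat"
    and "x \<in> bM k"
  shows "critical_variance A P fhat M x = ennreal ((cot (local_critical_radius A P fhat M (bM k) x))\<^sup>2)"
proof -
  interpret embedded_process A P fhat M bM k x
    using assms by unfold_locales
  show ?thesis by (rule critical_variance_eq_cot)
qed

end
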